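(* Let $Z$ be a centered Gaussian vector on $C(T)$ with covariance operator $\mathcal{K}:M(T)\to C(T)$ and law $P_0$. Then $$\overline{\mathcal{K}(M(T))}=\overline{H_{P_0}}=\operatorname{supp}P_0,$$ where closures are taken in $C(T)$ with respect to the sup norm.
   Context: $T\subset\mathbb{R}$ is a closed bounded interval; $C(T)$ is the Banach space of continuous real functions on $T$ with the sup norm; $M(T)=C(T)^*$ is the space of finite signed Borel measures on $T$; $\langle\mu,x\rangle=\int_T x_t\,\mu(dt)$. A centered Gaussian vector on $C(T)$ is a $C(T)$-valued random vector $Z$ such that $\langle\mu,Z\rangle$ is a centered normal variable for every $\mu\in M(T)$; its covariance operator is $(\mathcal{K}\mu)(s)=\int_TK(s,t)\,\mu(dt)$ with $K(s,t)=\mathrm{Cov}[Z_s,Z_t]$, which is continuous on $T^2$. $\operatorname{supp}P_0=\{x\in C(T): P_0(N)>0\text{ for every open neighbourhood }N\text{ of }x\}$. A vector $h\in C(T)$ is an admissible shift for $P_0$ if the measure $P_h(A)=P_0(A-h)$ ($A$ Borel in $C(T)$) is absolutely continuous with respect to $P_0$. The kernel is $H_{P_0}=\{h\in C(T): ch\text{ is an admissible shift for }P_0\text{ for all }c\in\mathbb{R}\}$. *)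

theory Defs
  imports "HOL-Probability.Probability"
begin

section \<open>The space C(T)\<close>

text \<open>Elements are the functions that are continuous on \<open>T\<close> and have the junk value
  \<open>undefined\<close> outside \<open>T\<close>, so that equality of representatives is equality on \<open>T\<close>;
  the distance is the sup distance. The linear operations are pointwise on \<open>T\<close>.\<close>

definition CT :: "real set \<Rightarrow> (real \<Rightarrow> real) metric" where
  "CT T = cfunspace (top_of_set T) euclidean_metric"

abbreviation CT_topology :: "real set \<Rightarrow> (real \<Rightarrow> real) topology" where
  "CT_topology T \<equiv> mtopology_of (CT T)"

definition CT_add :: "real set \<Rightarrow> (real \<Rightarrow> real) \<Rightarrow> (real \<Rightarrow> real) \<Rightarrow> real \<Rightarrow> real" where
  "CT_add T x y = (\<lambda>t\<in>T. x t + y t)"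

definition CT_scale :: "real set \<Rightarrow> real \<Rightarrow> (real \<Rightarrow> real) \<Rightarrow> real \<Rightarrow> real" where
  "CT_scale T c x = (\<lambda>t\<in>T. c * x t)"

definition CT_borel :: "real set \<Rightarrow> (real \<Rightarrow> real) measure" where
  "CT_borel T = sigma (mspace (CT T)) {U. openin (CT_topology T) U}"

lemma mspace_CT:
  assumes "compact T"
  shows "mspace (CT T) = {x \<in> extensional T. continuous_on T x}"
  using assms
  by (auto simp: CT_def compactin_mspace_cfunspace compactin_subtopology simp del: mspace_cfunspace)

lemma mdist_CT:
  assumes "compact T" "T \<noteq> {}" "x \<in> mspace (CT T)" "y \<in> mspace (CT T)"
  shows "mdist (CT T) x y = (SUP t\<in>T. \<bar>x t - y t\<bar>)"
proof -
  have "x \<in> Met_TC.fspace T" "y \<in> Met_TC.fspace T"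
    using assms(3,4) cfunspace_subset_funspace[of "top_of_set T" "euclidean_metric :: real metric"]
    by (auto simp: CT_def subset_iff)
  then show ?thesis
    using assms(2) by (simp add: CT_def mdist_cfunspace_eq_mdist_funspace Met_TC.fdist_def dist_real_def)
qed


section \<open>Finite signed Borel measures on T\<close>

text \<open>A finite signed Borel measure is a real-valued countably additive function on the Borel
  subsets of \<open>T\<close>. (Countable additivity forces \<open>\<mu> {} = 0\<close>; the values of the HOL function
  on non-Borel sets are irrelevant.)\<close>

definition signed_measures :: "real set \<Rightarrow> (real set \<Rightarrow> real) set" where
  "signed_measures T =
     {\<mu>. \<forall>A :: nat \<Rightarrow> real set. range A \<subseteq> sets (restrict_space borel T) \<longrightarrow> disjoint_family A \<longrightarrow>
           (\<lambda>i. \<mu> (A i)) sums \<mu> (\<Union>i. A i)}"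

text \<open>The integral is defined through the Jordan decomposition of \<open>\<mu>\<close> into its upper variation
  \<open>A \<mapsto> sup {\<mu> B | B \<subseteq> A}\<close> and its lower variation, i.e. the upper variation of \<open>- \<mu>\<close>.
  Since \<open>\<mu> {} = 0\<close>, truncating negative values by \<open>ennreal\<close> does not affect the supremum.\<close>

definition upper_variation :: "real set \<Rightarrow> (real set \<Rightarrow> real) \<Rightarrow> real measure" where
  "upper_variation T \<mu> = measure_of T (sets (restrict_space borel T))
     (\<lambda>A. SUP B \<in> {B \<in> sets (restrict_space borel T). B \<subseteq> A}. ennreal (\<mu> B))"

definition signed_integral :: "real set \<Rightarrow> (real set \<Rightarrow> real) \<Rightarrow> (real \<Rightarrow> real) \<Rightarrow> real" where
  "signed_integral T \<mu> x =
     integral\<^sup>L (upper_variation T \<mu>) x - integral\<^sup>L (upper_variation T (\<lambda>A. - \<mu> A)) x"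


section \<open>Centered Gaussian vectors on C(T)\<close>

text \<open>A centered normal variable may be degenerate, that is, almost surely zero.\<close>

definition centered_normal :: "'w measure \<Rightarrow> ('w \<Rightarrow> real) \<Rightarrow> bool" where
  "centered_normal M X \<longleftrightarrow>
     X \<in> borel_measurable M \<and>
     ((AE \<omega> in M. X \<omega> = 0) \<or> (\<exists>\<sigma>>0. distributed M lborel X (normal_density 0 \<sigma>)))"

definition centered_gaussian_vector ::
    "real set \<Rightarrow> 'w measure \<Rightarrow> ('w \<Rightarrow> real \<Rightarrow> real) \<Rightarrow> bool" where
  "centered_gaussian_vector T M Z \<longleftrightarrow>
     prob_space M \<and> Z \<in> measurable M (CT_borel T) \<and>
     (\<forall>\<mu> \<in> signed_measures T. centered_normal M (\<lambda>\<omega>. signed_integral T \<mu> (Z \<omega>)))"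

definition covariance :: "'w measure \<Rightarrow> ('w \<Rightarrow> real) \<Rightarrow> ('w \<Rightarrow> real) \<Rightarrow> real" where
  "covariance M X Y =
     (\<integral>\<omega>. (X \<omega> - (\<integral>\<omega>'. X \<omega>' \<partial>M)) * (Y \<omega> - (\<integral>\<omega>'. Y \<omega>' \<partial>M)) \<partial>M)"

definition cov_operator ::
    "real set \<Rightarrow> 'w measure \<Rightarrow> ('w \<Rightarrow> real \<Rightarrow> real) \<Rightarrow> (real set \<Rightarrow> real) \<Rightarrow> real \<Rightarrow> real" where
  "cov_operator T M Z \<mu> =
     (\<lambda>s\<in>T. signed_integral T \<mu> (\<lambda>t. covariance M (\<lambda>\<omega>. Z \<omega> s) (\<lambda>\<omega>. Z \<omega> t)))"

definition law :: "real set \<Rightarrow> 'w measure \<Rightarrow> ('w \<Rightarrow> real \<Rightarrow> real) \<Rightarrow> (real \<Rightarrow> real) measure" where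
  "law T M Z = distr M (CT_borel T) Z"


section \<open>Support, admissible shifts and kernel of a measure on C(T)\<close>

definition supp :: "real set \<Rightarrow> (real \<Rightarrow> real) measure \<Rightarrow> (real \<Rightarrow> real) set" where
  "supp T P = {x \<in> mspace (CT T). \<forall>N. openin (CT_topology T) N \<and> x \<in> N \<longrightarrow> emeasure P N > 0}"

text \<open>The image of \<open>P\<close> under \<open>x \<mapsto> x + h\<close>; its value at \<open>A\<close> is \<open>P (A - h)\<close>,
  see \<open>emeasure_shift\<close> below.\<close>

definition shift :: "real set \<Rightarrow> (real \<Rightarrow> real) measure \<Rightarrow> (real \<Rightarrow> real) \<Rightarrow> (real \<Rightarrow> real) measure" where
  "shift T P h = distr P (CT_borel T) (\<lambda>x. CT_add T x h)"

definition admissible_shift :: "real set \<Rightarrow> (real \<Rightarrow> real) measure \<Rightarrow> (real \<Rightarrow> real) \<Rightarrow> bool" where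
  "admissible_shift T P h \<longleftrightarrow> h \<in> mspace (CT T) \<and> absolutely_continuous P (shift T P h)"

definition shift_kernel :: "real set \<Rightarrow> (real \<Rightarrow> real) measure \<Rightarrow> (real \<Rightarrow> real) set" where
  "shift_kernel T P = {h \<in> mspace (CT T). \<forall>c. admissible_shift T P (CT_scale T c h)}"

lemma space_CT_borel: "space (CT_borel T) = mspace (CT T)"
  by (simp add: CT_borel_def space_measure_of_conv)

lemma sets_CT_borel:
  "sets (CT_borel T) = sigma_sets (mspace (CT T)) {U. openin (CT_topology T) U}"
  unfolding CT_borel_def
  by (rule sets_measure_of) (use openin_subset in fastforce)

lemma CT_add_mem:
  assumes "compact T" "x \<in> mspace (CT T)" "h \<in> mspace (CT T)"
  shows "CT_add T x h \<in> mspace (CT T)"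
proof -
  have "continuous_on T (\<lambda>t. x t + h t)"
    using assms by (auto simp: mspace_CT intro!: continuous_intros)
  then have "continuous_on T (CT_add T x h)"
    by (rule continuous_on_eq) (simp add: CT_add_def)
  then show ?thesis
    using assms(1) by (simp add: mspace_CT CT_add_def)
qed

lemma measurable_CT_add:
  assumes "compact T" "T \<noteq> {}" and h: "h \<in> mspace (CT T)"
  shows "(\<lambda>x. CT_add T x h) \<in> measurable (CT_borel T) (CT_borel T)"
proof -
  have iso: "mdist (CT T) (CT_add T x h) (CT_add T y h) = mdist (CT T) x y"
    if "x \<in> mspace (CT T)" "y \<in> mspace (CT T)" for x y
    using mdist_CT[OF assms(1,2) CT_add_mem CT_add_mem] mdist_CT[OF assms(1,2)] that assms
    by (simp add: CT_add_def cong: SUP_cong_simp)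
  have "continuous_map (CT_topology T) (CT_topology T) (\<lambda>x. CT_add T x h)"
    unfolding mtopology_of_def
      Metric_space.metric_continuous_map[OF Metric_space_mspace_mdist Metric_space_mspace_mdist]
    using CT_add_mem[OF assms(1) _ h] iso by (auto intro!: exI)
  then have cont: "openin (CT_topology T) {x \<in> mspace (CT T). CT_add T x h \<in> U}"
    if "openin (CT_topology T) U" for U
    using that by (auto simp: continuous_map_def)
  have vimage: "(\<lambda>x. CT_add T x h) -` U \<inter> space (CT_borel T) = {x \<in> mspace (CT T). CT_add T x h \<in> U}"
    for U by (auto simp: space_CT_borel)
  show ?thesis
  proof (rule measurable_sigma_sets[OF sets_CT_borel])
    show "{U. openin (CT_topology T) U} \<subseteq> Pow (mspace (CT T))"
      using openin_subset by fastforce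
    show "(\<lambda>x. CT_add T x h) \<in> space (CT_borel T) \<rightarrow> mspace (CT T)"
      using CT_add_mem[OF assms(1) _ h] by (auto simp: space_CT_borel)
    show "(\<lambda>x. CT_add T x h) -` U \<inter> space (CT_borel T) \<in> sets (CT_borel T)"
      if "U \<in> {U. openin (CT_topology T) U}" for U
      using cont[of U] that unfolding vimage sets_CT_borel by auto
  qed
qed

lemma emeasure_shift:
  assumes "compact T" "T \<noteq> {}" and h: "h \<in> mspace (CT T)"
    and P: "sets P = sets (CT_borel T)" and A: "A \<in> sets (CT_borel T)"
  shows "emeasure (shift T P h) A = emeasure P ((\<lambda>x. \<lambda>t\<in>T. x t - h t) ` A)"
proof -
  have AC: "A \<subseteq> mspace (CT T)"
    using sets.sets_into_space[OF A] by (simp add: space_CT_borel)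
  have sp: "space P = mspace (CT T)"
    using sets_eq_imp_space_eq[OF P] by (simp add: space_CT_borel)
  have meas: "(\<lambda>x. CT_add T x h) \<in> measurable P (CT_borel T)"
    using measurable_CT_add[OF assms(1-3)] P by (simp cong: measurable_cong_sets)
  have ext: "x \<in> extensional T" if "x \<in> mspace (CT T)" for x
    using that assms(1) by (simp add: mspace_CT)
  have "(\<lambda>x. CT_add T x h) -` A \<inter> space P = (\<lambda>x. \<lambda>t\<in>T. x t - h t) ` A"
  proof (intro equalityI subsetI)
    fix x assume x: "x \<in> (\<lambda>x. CT_add T x h) -` A \<inter> space P"
    then have "x = (\<lambda>t\<in>T. CT_add T x h t - h t)"
      using ext[of x] by (auto simp: sp CT_add_def fun_eq_iff extensional_def)
    with x show "x \<in> (\<lambda>x. \<lambda>t\<in>T. x t - h t) ` A" by blast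
  next
    fix y assume "y \<in> (\<lambda>x. \<lambda>t\<in>T. x t - h t) ` A"
    then obtain x where x: "x \<in> A" and y: "y = (\<lambda>t\<in>T. x t - h t)" by blast
    have "CT_add T y h = x"
      using ext[of x] x AC by (auto simp: y CT_add_def fun_eq_iff extensional_def)
    moreover have "continuous_on T (\<lambda>t. x t - h t)"
      using assms(1) h x AC by (auto simp: mspace_CT intro!: continuous_intros)
    then have "continuous_on T y"
      by (rule continuous_on_eq) (simp add: y)
    then have "y \<in> mspace (CT T)"
      using assms(1) by (simp add: mspace_CT y)
    ultimately show "y \<in> (\<lambda>x. CT_add T x h) -` A \<inter> space P"
      using x by (simp add: sp)
  qed
  then show ?thesis
    using meas A by (simp add: shift_def emeasure_distr)
qed

end

theory Submission
  imports Defs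
begin

text \<open>
  Call a finite linear combination of evaluations \<open>x \<mapsto> x t\<close> a point functional, i.e. the integral
  against a finitely supported signed measure, and let \<open>kern f\<close> be the path \<open>s \<mapsto> Cov (x s, f x)\<close>
  under the law \<open>P\<close> of the Gaussian vector. All three closures are compared with the closure \<open>L\<close> of
  the set of all \<open>kern f\<close>.

  The closure of the range of the covariance operator is \<open>L\<close>. The covariance function is
  uniformly continuous, and a signed measure is bounded, so its integral against covariance
  functions can be replaced, uniformly, by a finite sum (\<open>signed_cov_approx\<close>).

  Every \<open>kern f\<close> belongs to the shift kernel (\<open>kern_in_shift_kernel\<close>). If \<open>f\<close> has variance one, then \<open>x\<close>
  is the independent sum of \<open>x - f x * kern f\<close> and of the multiple \<open>f x\<close> of \<open>kern f\<close>. A shift along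
  \<open>kern f\<close> only translates the normal variable \<open>f x\<close>, which gives an equivalent law.

  The support is contained in \<open>L\<close> (\<open>supp_subset_closure_kern\<close>). Given a finite net in \<open>T\<close>, let \<open>\<pi> x\<close> be
  the conditional expectation of the path given its values on the net; it is some \<open>kern f\<close>.
  The reflected path \<open>x - 2 \<pi> x\<close> has the same law as \<open>x\<close>. The residual \<open>x - \<pi> x\<close> is the mean of \<open>x\<close> and
  of the reflected path, so its modulus of continuity is small with high probability; as it vanishes
  on the net, it is uniformly small. This replaces a separation argument with the Hahn--Banach and
  Riesz theorems.

  Finally, the support is closed, not empty because C(T) is separable, and invariant under
  admissible directions. It contains a limit \<open>x\<close> of functions \<open>kern f\<close>, hence also limits of
  \<open>x - kern f\<close>, such as zero, and with zero the whole shift kernel. Therefore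
  \<open>supp P \<subseteq> L \<subseteq> closure H \<subseteq> supp P\<close>, where \<open>H\<close> is the shift kernel.

  Two laws on C(T) are identified above by their characteristic functions on point functionals
  (\<open>law_unique\<close>).
\<close>

section \<open>The topology and the Borel sets of C(T)\<close>

text \<open>All topological notions of C(T) are first expressed through uniform closeness on the
  interval \<open>T\<close>.\<close>

locale interval_space =
  fixes a b :: real and T :: "real set"
  assumes interval: "a \<le> b" "T = {a..b}"
begin

lemma compact_T: "compact T" and T_nonempty: "T \<noteq> {}"
  using interval by auto

lemma mspace_CT_iff: "x \<in> mspace (CT T) \<longleftrightarrow> x \<in> extensional T \<and> continuous_on T x"
  by (simp add: mspace_CT[OF compact_T])

lemma mspace_CT_cont: "x \<in> mspace (CT T) \<Longrightarrow> continuous_on T x"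
  by (simp add: mspace_CT_iff)

lemma restrict_in_mspace: "continuous_on T x \<Longrightarrow> (\<lambda>t\<in>T. x t) \<in> mspace (CT T)"
  by (auto simp: mspace_CT_iff cong: continuous_on_cong)

lemma mdist_CT_le_iff:
  assumes "x \<in> mspace (CT T)" "y \<in> mspace (CT T)"
  shows "mdist (CT T) x y \<le> e \<longleftrightarrow> (\<forall>t\<in>T. \<bar>x t - y t\<bar> \<le> e)"
proof -
  have "continuous_on T (\<lambda>t. \<bar>x t - y t\<bar>)"
    using assms by (intro continuous_intros mspace_CT_cont)
  then have "bdd_above ((\<lambda>t. \<bar>x t - y t\<bar>) ` T)"
    using compact_T by (intro bounded_imp_bdd_above compact_imp_bounded compact_continuous_image)
  then show ?thesis
    using mdist_CT[OF compact_T T_nonempty assms] T_nonempty by (simp add: cSUP_le_iff)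
qed

lemma openin_CT_iff:
  "openin (CT_topology T) U \<longleftrightarrow> U \<subseteq> mspace (CT T) \<and>
     (\<forall>x\<in>U. \<exists>r>0. \<forall>y\<in>mspace (CT T). (\<forall>t\<in>T. \<bar>x t - y t\<bar> \<le> r) \<longrightarrow> y \<in> U)"
proof -
  have ball: "Metric_space.mcball (mspace (CT T)) (mdist (CT T)) x r \<subseteq> U \<longleftrightarrow>
     (\<forall>y\<in>mspace (CT T). (\<forall>t\<in>T. \<bar>x t - y t\<bar> \<le> r) \<longrightarrow> y \<in> U)"
    if "x \<in> mspace (CT T)" for x r
    using that
    by (auto simp: Metric_space.mcball_def[OF Metric_space_mspace_mdist] mdist_CT_le_iff subset_iff)
  show ?thesis
    unfolding mtopology_of_def Metric_space.openin_mtopology_mcball[OF Metric_space_mspace_mdist]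
      Ball_def[of U]
    by (rule conj_cong[OF refl], rule all_cong1, rule imp_cong[OF refl]) (simp add: ball subsetD)
qed

lemma in_closure_CT_iff:
  "x \<in> CT_topology T closure_of S \<longleftrightarrow> x \<in> mspace (CT T) \<and>
     (\<forall>e>0. \<exists>y\<in>S \<inter> mspace (CT T). \<forall>t\<in>T. \<bar>x t - y t\<bar> \<le> e)"
proof -
  have ball: "(\<exists>y\<in>S. y \<in> Metric_space.mcball (mspace (CT T)) (mdist (CT T)) x e) \<longleftrightarrow>
      (\<exists>y\<in>S \<inter> mspace (CT T). \<forall>t\<in>T. \<bar>x t - y t\<bar> \<le> e)"
    if "x \<in> mspace (CT T)" for e
    using that
    by (simp add: Metric_space.mcball_def[OF Metric_space_mspace_mdist] mdist_CT_le_iff Bex_def conj_ac cong: conj_cong)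
  show ?thesis
    unfolding mtopology_of_def Metric_space.metric_closure_of_alt[OF Metric_space_mspace_mdist]
    by (simp add: ball cong: conj_cong)
qed

lemma mspace_CT_uniformly_continuous:
  assumes "x \<in> mspace (CT T)" "e > 0"
  obtains d where "d > 0" "\<And>s t. \<lbrakk>s \<in> T; t \<in> T; \<bar>s - t\<bar> \<le> d\<rbrakk> \<Longrightarrow> \<bar>x s - x t\<bar> \<le> e"
proof -
  have "uniformly_continuous_on T x"
    using assms compact_T by (intro compact_uniformly_continuous mspace_CT_cont)
  then obtain d where d: "d > 0" "\<And>s t. \<lbrakk>s \<in> T; t \<in> T; dist t s < d\<rbrakk> \<Longrightarrow> dist (x t) (x s) < e"
    using assms(2) unfolding uniformly_continuous_on_def by blast
  show thesis
  proof (rule that[of "d/2"])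
    show "\<bar>x s - x t\<bar> \<le> e" if "s \<in> T" "t \<in> T" "\<bar>s - t\<bar> \<le> d/2" for s t
      using d(2)[of t s] that d(1) by (simp add: dist_real_def)
  qed (use d in simp)
qed

text \<open>C(T) is separable: the Bernstein polynomials with rational coefficients, transported from
  the unit interval to \<open>T\<close>, are dense.\<close>

lemma separable_CT:
  obtains D where "countable D" "D \<subseteq> mspace (CT T)"
    "\<And>x e. \<lbrakk>x \<in> mspace (CT T); e > 0\<rbrakk> \<Longrightarrow> \<exists>d\<in>D. \<forall>t\<in>T. \<bar>x t - d t\<bar> \<le> e"
proof -
  define u where "u t = (t - a) / (b - a)" for t
  define p where "p = (\<lambda>qs :: rat list. \<lambda>t\<in>T. \<Sum>k\<le>length qs - 1. of_rat (qs ! k) * Bernstein (length qs - 1) k (u t))"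
  have u01: "0 \<le> u t" "u t \<le> 1" if "t \<in> T" for t
    using that interval by (auto simp: u_def divide_le_eq_1)
  have u_inv: "a + (b - a) * u t = t" if "t \<in> T" for t
    using that interval by (cases "a = b") (auto simp: u_def)
  have "continuous_on T u"
  proof (cases "a = b")
    case False
    then show ?thesis
      unfolding u_def by (intro continuous_intros) auto
  qed (simp add: u_def)
  then have "p qs \<in> mspace (CT T)" for qs
    unfolding p_def Bernstein_def by (intro restrict_in_mspace continuous_intros)
  moreover have "\<exists>d\<in>range p. \<forall>t\<in>T. \<bar>x t - d t\<bar> \<le> e" if x: "x \<in> mspace (CT T)" and e: "e > 0" for x e
  proof -
    define f where "f s = x (a + (b - a) * s)" for s
    have "continuous_on {0..1} f"
      unfolding f_def
    proof (rule continuous_on_compose2[OF mspace_CT_cont[OF x]])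
      show "(\<lambda>s. a + (b - a) * s) ` {0..1} \<subseteq> T"
      proof (rule image_subsetI)
        fix s :: real assume "s \<in> {0..1}"
        then show "a + (b - a) * s \<in> T"
          using interval mult_left_mono[of s 1 "b - a"] by simp
      qed
    qed (intro continuous_intros)
    from Bernstein_Weierstrass[OF this, of "e/2"] e obtain n where n:
      "\<And>s. s \<in> {0..1} \<Longrightarrow> \<bar>f s - (\<Sum>k\<le>n. f (k/n) * Bernstein n k s)\<bar> < e/2"
      by (metis half_gt_zero order_refl)
    have "\<exists>q. \<bar>f (k/n) - of_rat q\<bar> \<le> e/2" for k :: nat
    proof -
      obtain q where "f (k/n) - e/2 < of_rat q" "of_rat q < f (k/n) + e/2"
        using of_rat_dense[of "f (k/n) - e/2" "f (k/n) + e/2"] e by auto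
      then show ?thesis by (intro exI[of _ q]) linarith
    qed
    then obtain q where q: "\<And>k :: nat. \<bar>f (k/n) - of_rat (q k)\<bar> \<le> e/2" by metis
    define qs where "qs = map q [0..<Suc n]"
    have len: "length qs - 1 = n" by (simp add: qs_def)
    have nth: "qs ! k = q k" if "k \<le> n" for k
      using that by (simp add: qs_def del: upt_Suc)
    have "\<bar>x t - p qs t\<bar> \<le> e" if t: "t \<in> T" for t
    proof -
      have B: "0 \<le> Bernstein n k (u t)" for k
        using u01[OF t] by (simp add: Bernstein_nonneg)
      have "p qs t = (\<Sum>k\<le>n. of_rat (q k) * Bernstein n k (u t))"
        unfolding p_def len using t by (auto intro!: sum.cong simp: nth)
      then have "\<bar>(\<Sum>k\<le>n. f (k/n) * Bernstein n k (u t)) - p qs t\<bar>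
          = \<bar>\<Sum>k\<le>n. (f (k/n) - of_rat (q k)) * Bernstein n k (u t)\<bar>"
        by (simp add: sum_subtractf left_diff_distrib)
      also have "\<dots> \<le> (\<Sum>k\<le>n. e/2 * Bernstein n k (u t))"
        using mult_right_mono[OF q B]
        by (intro order_trans[OF sum_abs] sum_mono) (simp add: abs_mult abs_of_nonneg[OF B])
      also have "\<dots> = e/2"
        unfolding sum_distrib_left[symmetric] by simp
      finally have "\<bar>(\<Sum>k\<le>n. f (k/n) * Bernstein n k (u t)) - p qs t\<bar> \<le> e/2" .
      moreover have "f (u t) = x t"
        using u_inv[OF t] by (simp add: f_def)
      moreover have "\<bar>f (u t) - (\<Sum>k\<le>n. f (k/n) * Bernstein n k (u t))\<bar> < e/2"
        using u01[OF t] by (intro n) simp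
      ultimately show ?thesis
        by linarith
    qed
    then show ?thesis by blast
  qed
  ultimately show thesis
    by (intro that[of "range p"]) auto
qed

text \<open>The cylinder sets, given by finitely many coordinates. By separability every open set is a
  countable union of closed balls, and a closed ball is a countable intersection of cylinders.
  So the cylinders generate the Borel sets.\<close>

definition cylinders :: "(real \<Rightarrow> real) set set" where
  "cylinders = {{x \<in> mspace (CT T). \<forall>t\<in>F. x t \<in> A t} |F A. finite F \<and> F \<subseteq> T \<and> (\<forall>t. A t \<in> sets borel)}"

lemma cylinders_subset: "cylinders \<subseteq> Pow (mspace (CT T))"
  by (auto simp: cylinders_def)

lemma eval_measurable:
  assumes t: "t \<in> T"
  shows "(\<lambda>x. x t) \<in> borel_measurable (CT_borel T)"
proof (rule borel_measurableI)
  fix S :: "real set" assume S: "open S"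
  have "openin (CT_topology T) {x \<in> mspace (CT T). x t \<in> S}"
  proof -
    have "\<exists>r>0. \<forall>y\<in>mspace (CT T). (\<forall>t\<in>T. \<bar>x t - y t\<bar> \<le> r) \<longrightarrow> y t \<in> S" if "x t \<in> S" for x
    proof -
      obtain r where "r > 0" "cball (x t) r \<subseteq> S"
        using S \<open>x t \<in> S\<close> open_contains_cball by blast
      then show ?thesis
        using t by (intro exI[of _ r]) (auto simp: subset_iff dist_real_def)
    qed
    then show ?thesis by (auto simp: openin_CT_iff)
  qed
  moreover have "(\<lambda>x. x t) -` S \<inter> space (CT_borel T) = {x \<in> mspace (CT T). x t \<in> S}"
    by (auto simp: space_CT_borel)
  ultimately show "(\<lambda>x. x t) -` S \<inter> space (CT_borel T) \<in> sets (CT_borel T)"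
    by (simp add: sets_CT_borel)
qed

lemma cylinder_in_sets:
  assumes "finite F" "F \<subseteq> T" "\<And>t. A t \<in> sets borel"
  shows "{x \<in> mspace (CT T). \<forall>t\<in>F. x t \<in> A t} \<in> sets (CT_borel T)"
proof -
  have "{x \<in> space (CT_borel T). x t \<in> A t} \<in> sets (CT_borel T)" if "t \<in> F" for t
    using measurable_sets[OF eval_measurable assms(3), of t t] that assms(2)
    by (auto simp: vimage_def Int_def conj_commute)
  then have "{x \<in> space (CT_borel T). \<forall>t\<in>F. x t \<in> A t} \<in> sets (CT_borel T)"
    using assms(1) by (rule sets.sets_Collect_finite_All)
  then show ?thesis by (simp add: space_CT_borel)
qed

lemma cball_in_sigma_cylinders:
  assumes d: "d \<in> mspace (CT T)"
  shows "{x \<in> mspace (CT T). \<forall>t\<in>T. \<bar>x t - d t\<bar> \<le> r} \<in> sigma_sets (mspace (CT T)) cylinders"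
proof -
  interpret sa: sigma_algebra "mspace (CT T)" "sigma_sets (mspace (CT T)) cylinders"
    by (rule sigma_algebra_sigma_sets[OF cylinders_subset])
  obtain S where S: "countable S" "S \<subseteq> T" "T \<subseteq> closure S" by (rule separable[of T])
  then have ST: "closure S = T"
    using interval closure_minimal[of S T] by auto
  have eq: "{x \<in> mspace (CT T). \<forall>t\<in>T. \<bar>x t - d t\<bar> \<le> r} =
     mspace (CT T) \<inter> (\<Inter>s\<in>S. {x \<in> mspace (CT T). \<forall>t\<in>{s}. x t \<in> cball (d t) r})" (is "?L = ?R")
  proof
    show "?L \<subseteq> ?R" using S(2) by (auto simp: dist_real_def abs_minus_commute)
    show "?R \<subseteq> ?L"
    proof
      fix x assume x: "x \<in> ?R"
      then have "continuous_on (closure S) (\<lambda>t. \<bar>x t - d t\<bar>)"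
        unfolding ST using d by (intro continuous_intros mspace_CT_cont) auto
      then show "x \<in> ?L"
        using x continuous_le_on_closure[of S "\<lambda>t. \<bar>x t - d t\<bar>" _ r]
        by (auto simp: dist_real_def abs_minus_commute ST)
    qed
  qed
  have "{x \<in> mspace (CT T). \<forall>t\<in>{s}. x t \<in> cball (d t) r} \<in> sigma_sets (mspace (CT T)) cylinders" if "s \<in> S" for s
  proof (rule sigma_sets.Basic)
    show "{x \<in> mspace (CT T). \<forall>t\<in>{s}. x t \<in> cball (d t) r} \<in> cylinders"
      unfolding cylinders_def using that S
      by (intro CollectI exI[of _ "{s}"] exI[of _ "\<lambda>t. cball (d t) r"]) auto
  qed
  then show ?thesis
    unfolding eq using S(1) S(2,3) T_nonempty
    by (intro sa.Int sa.top sa.countable_INT') auto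
qed

lemma sets_CT_borel_eq_cylinders:
  "sets (CT_borel T) = sigma_sets (mspace (CT T)) cylinders"
proof -
  obtain D where D: "countable D" "D \<subseteq> mspace (CT T)"
    "\<And>x e. \<lbrakk>x \<in> mspace (CT T); e > 0\<rbrakk> \<Longrightarrow> \<exists>d\<in>D. \<forall>t\<in>T. \<bar>x t - d t\<bar> \<le> e"
    using separable_CT by blast
  interpret sa: sigma_algebra "mspace (CT T)" "sigma_sets (mspace (CT T)) cylinders"
    by (rule sigma_algebra_sigma_sets[OF cylinders_subset])
  let ?cb = "\<lambda>d r. {x \<in> mspace (CT T). \<forall>t\<in>T. \<bar>x t - d t\<bar> \<le> r}"
  have "U \<in> sigma_sets (mspace (CT T)) cylinders" if U: "openin (CT_topology T) U" for U
  proof -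
    define I where "I = {(d, r). d \<in> D \<and> r \<in> \<rat> \<and> ?cb d r \<subseteq> U}"
    have "I \<subseteq> D \<times> \<rat>" by (auto simp: I_def)
    then have I: "countable I"
      by (rule countable_subset) (intro countable_SIGMA D(1) countable_rat)
    have "U = (\<Union>(d, r)\<in>I. ?cb d r)"
    proof
      show "U \<subseteq> (\<Union>(d, r)\<in>I. ?cb d r)"
      proof
        fix x assume x: "x \<in> U"
        then have xm: "x \<in> mspace (CT T)"
          using U openin_subset by fastforce
        obtain r where r: "r > 0" "\<And>y. \<lbrakk>y \<in> mspace (CT T); \<forall>t\<in>T. \<bar>x t - y t\<bar> \<le> r\<rbrakk> \<Longrightarrow> y \<in> U"
          using U x unfolding openin_CT_iff by blast
        obtain q where q: "q \<in> \<rat>" "0 < q" "q < r/2"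
          using Rats_dense_in_real[of 0 "r/2"] r(1) by auto
        obtain d where d: "d \<in> D" "\<And>t. t \<in> T \<Longrightarrow> \<bar>x t - d t\<bar> \<le> q"
          using D(3)[OF xm q(2)] by blast
        have "y \<in> U" if y: "y \<in> ?cb d q" for y
        proof (rule r(2))
          show "\<forall>t\<in>T. \<bar>x t - y t\<bar> \<le> r"
          proof
            fix t assume t: "t \<in> T"
            then have "\<bar>y t - d t\<bar> \<le> q" using y by auto
            then show "\<bar>x t - y t\<bar> \<le> r" using d(2)[OF t] q(3) by linarith
          qed
        qed (use y in auto)
        then have "(d, q) \<in> I" using d q by (auto simp: I_def)
        moreover have "x \<in> ?cb d q" using xm d(2) by auto
        ultimately show "x \<in> (\<Union>(d, r)\<in>I. ?cb d r)" by blast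
      qed
    qed (auto simp: I_def)
    moreover have "(\<Union>(d, r)\<in>I. ?cb d r) \<in> sigma_sets (mspace (CT T)) cylinders"
      using I D(2) by (intro sa.countable_UN'') (auto simp: I_def intro!: cball_in_sigma_cylinders)
    ultimately show ?thesis by simp
  qed
  then show ?thesis
    unfolding sets_CT_borel
    using cylinder_in_sets
    by (intro sigma_sets_eqI) (auto simp: cylinders_def sets_CT_borel)
qed

lemma Int_stable_cylinders: "Int_stable cylinders"
proof (rule Int_stableI)
  fix C D assume "C \<in> cylinders" "D \<in> cylinders"
  then obtain F A G B where C: "C = {x \<in> mspace (CT T). \<forall>t\<in>F. x t \<in> A t}" "finite F" "F \<subseteq> T" "\<forall>t. A t \<in> sets borel"
    and D: "D = {x \<in> mspace (CT T). \<forall>t\<in>G. x t \<in> B t}" "finite G" "G \<subseteq> T" "\<forall>t. B t \<in> sets borel"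
    unfolding cylinders_def by blast
  define E where "E t = (if t \<in> F then A t else UNIV) \<inter> (if t \<in> G then B t else UNIV)" for t
  have "C \<inter> D = {x \<in> mspace (CT T). \<forall>t\<in>F \<union> G. x t \<in> E t}"
    by (auto simp: C(1) D(1) E_def)
  then show "C \<inter> D \<in> cylinders"
    unfolding cylinders_def using C(2-) D(2-)
    by (intro CollectI exI[of _ "F \<union> G"] exI[of _ E]) (auto simp: E_def)
qed

text \<open>In particular a map into C(T) is measurable as soon as its coordinates are.\<close>

lemma measurable_CT_borelI:
  assumes "\<And>\<omega>. \<omega> \<in> space N \<Longrightarrow> f \<omega> \<in> mspace (CT T)"
    and "\<And>t. t \<in> T \<Longrightarrow> (\<lambda>\<omega>. f \<omega> t) \<in> borel_measurable N"
  shows "f \<in> measurable N (CT_borel T)"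
proof (rule measurable_sigma_sets[OF sets_CT_borel_eq_cylinders cylinders_subset])
  fix C assume "C \<in> cylinders"
  then obtain F A where C: "C = {x \<in> mspace (CT T). \<forall>t\<in>F. x t \<in> A t}" "finite F" "F \<subseteq> T" "\<And>t. A t \<in> sets borel"
    unfolding cylinders_def by blast
  have "{\<omega> \<in> space N. f \<omega> t \<in> A t} \<in> sets N" if "t \<in> F" for t
    using measurable_sets[OF assms(2) C(4), of t t] that C(3)
    by (auto simp: vimage_def Int_def conj_commute)
  then have "{\<omega> \<in> space N. \<forall>t\<in>F. f \<omega> t \<in> A t} \<in> sets N"
    using C(2) by (rule sets.sets_Collect_finite_All)
  also have "{\<omega> \<in> space N. \<forall>t\<in>F. f \<omega> t \<in> A t} = f -` C \<inter> space N"
    using assms(1) by (auto simp: C(1))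
  finally show "f -` C \<inter> space N \<in> sets N" .
qed (use assms(1) in auto)

text \<open>A measure on C(T) that is not zero has a point in its support, by separability.\<close>

lemma supp_nonempty:
  assumes P: "sets P = sets (CT_borel T)" and "emeasure P (space P) \<noteq> 0"
  shows "supp T P \<noteq> {}"
proof
  assume empty: "supp T P = {}"
  obtain D where D: "countable D" "D \<subseteq> mspace (CT T)"
    "\<And>x e. \<lbrakk>x \<in> mspace (CT T); e > 0\<rbrakk> \<Longrightarrow> \<exists>d\<in>D. \<forall>t\<in>T. \<bar>x t - d t\<bar> \<le> e"
    using separable_CT by blast
  have sp: "space P = mspace (CT T)"
    using sets_eq_imp_space_eq[OF P] by (simp add: space_CT_borel)
  let ?cb = "\<lambda>d r. {x \<in> mspace (CT T). \<forall>t\<in>T. \<bar>x t - d t\<bar> \<le> r}"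
  define I where "I = {(d, r). d \<in> D \<and> r \<in> \<rat> \<and> ?cb d r \<in> null_sets P}"
  have "I \<subseteq> D \<times> \<rat>" by (auto simp: I_def)
  then have I: "countable I"
    by (rule countable_subset) (intro countable_SIGMA D(1) countable_rat)
  have "mspace (CT T) \<subseteq> (\<Union>(d, r)\<in>I. ?cb d r)"
  proof
    fix x assume x: "x \<in> mspace (CT T)"
    then obtain U where U: "openin (CT_topology T) U" "x \<in> U" "emeasure P U = 0"
      using empty by (auto simp: supp_def)
    obtain r where r: "r > 0" "\<And>y. \<lbrakk>y \<in> mspace (CT T); \<forall>t\<in>T. \<bar>x t - y t\<bar> \<le> r\<rbrakk> \<Longrightarrow> y \<in> U"
      using U unfolding openin_CT_iff by blast
    obtain q where q: "q \<in> \<rat>" "0 < q" "q < r/2"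
      using Rats_dense_in_real[of 0 "r/2"] r(1) by auto
    obtain d where d: "d \<in> D" "\<And>t. t \<in> T \<Longrightarrow> \<bar>x t - d t\<bar> \<le> q"
      using D(3)[OF x q(2)] by blast
    have "y \<in> U" if y: "y \<in> ?cb d q" for y
    proof (rule r(2))
      show "\<forall>t\<in>T. \<bar>x t - y t\<bar> \<le> r"
      proof
        fix t assume t: "t \<in> T"
        then have "\<bar>y t - d t\<bar> \<le> q" using y by auto
        then show "\<bar>x t - y t\<bar> \<le> r" using d(2)[OF t] q(3) by linarith
      qed
    qed (use y in auto)
    moreover have "?cb d q \<in> sets P"
      using cball_in_sigma_cylinders D(2) d(1) by (auto simp: P sets_CT_borel_eq_cylinders)
    moreover have "U \<in> sets P"
      using U(1) by (auto simp: P sets_CT_borel)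
    ultimately have "?cb d q \<in> null_sets P"
      using U(3) null_sets_subset[of U P "?cb d q"] by (auto simp: null_sets_def)
    then have "(d, q) \<in> I" using d q by (auto simp: I_def)
    moreover have "x \<in> ?cb d q" using x d(2) by auto
    ultimately show "x \<in> (\<Union>(d, r)\<in>I. ?cb d r)" by blast
  qed
  moreover have "(\<Union>(d, r)\<in>I. ?cb d r) \<in> null_sets P"
    using I by (intro null_sets_UN') (auto simp: I_def)
  ultimately have "space P \<in> null_sets P"
    using null_sets_subset[of "(\<Union>(d, r)\<in>I. ?cb d r)" P "space P"] by (auto simp: sp[symmetric])
  then show False using assms(2) by (simp add: null_setsD1)
qed

end

section \<open>Uniqueness of laws on C(T)\<close>

text \<open>The image under \<open>X\<close> of a probability measure with the weight \<open>w\<close>, normalized by the total mass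
  \<open>m\<close>. The real and the imaginary part of \<open>exp (\<i> s X)\<close> are both of the form \<open>cos (s X + \<theta>)\<close>, with
  \<open>\<theta> = 0\<close> and \<open>\<theta> = - \<pi> / 2\<close>; so characteristic functions can be handled by integrals of real
  cosines.\<close>

lemma weighted_distr:
  fixes X w :: "'a \<Rightarrow> real"
  assumes R: "prob_space R" and X: "X \<in> borel_measurable R" and w: "w \<in> borel_measurable R"
    and w0: "\<And>x. 0 \<le> w x" and wB: "\<And>x. w x \<le> B"
    and m: "m = (\<integral>x. w x \<partial>R)" "m \<noteq> 0"
    and D: "D = distr (density R (\<lambda>x. ennreal (w x / m))) borel X"
  shows "real_distribution D"
    and "char D s = Complex ((\<integral>x. w x * cos (s * X x + 0) \<partial>R) / m) ((\<integral>x. w x * cos (s * X x + - pi / 2) \<partial>R) / m)"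
    and "A \<in> sets borel \<Longrightarrow> measure D A = (\<integral>x. w x * indicator A (X x) \<partial>R) / m"
proof -
  interpret R: prob_space R by (rule R)
  note [measurable] = X w
  have bounded: "integrable R (\<lambda>x. w x * g x)" if "g \<in> borel_measurable R" "\<And>x. \<bar>g x\<bar> \<le> 1" for g
  proof (rule R.integrable_const_bound[where B = B])
    show "AE x in R. norm (w x * g x) \<le> B"
      using mult_mono[OF wB that(2) _ abs_ge_zero] w0 wB order_trans[OF w0 wB]
      by (auto simp: abs_mult)
  qed (use that in measurable)
  have mpos: "m > 0"
    using m w0 by (simp add: less_le)
  have int_w: "integrable R w" using bounded[of "\<lambda>_. 1"] by simp
  have "prob_space (density R (\<lambda>x. ennreal (w x / m)))"
  proof (rule prob_spaceI)
    have "(\<integral>\<^sup>+x. ennreal (w x / m) \<partial>R) = ennreal (\<integral>x. w x / m \<partial>R)"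
      using int_w w0 mpos by (intro nn_integral_eq_integral) auto
    also have "\<dots> = 1" using m by simp
    finally show "emeasure (density R (\<lambda>x. ennreal (w x / m))) (space (density R (\<lambda>x. ennreal (w x / m)))) = 1"
      by (simp add: emeasure_density cong: nn_integral_cong)
  qed
  then interpret d: prob_space "density R (\<lambda>x. ennreal (w x / m))" .
  show "real_distribution D"
    unfolding D by (rule d.real_distribution_distr) simp
  have ch: "char D s = (CLINT x|R. (w x / m) *\<^sub>R iexp (s * X x))"
    unfolding char_def D using w0 mpos by (simp add: integral_distr integral_density)
  have int: "complex_integrable R (\<lambda>x. (w x / m) *\<^sub>R iexp (s * X x))"
  proof (rule R.integrable_const_bound[where B = "B / m"])
    show "AE x in R. norm ((w x / m) *\<^sub>R iexp (s * X x)) \<le> B / m"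
      using w0 wB mpos by (simp add: divide_right_mono)
  qed measurable
  have re: "(\<integral>x. Re ((w x / m) *\<^sub>R iexp (s * X x)) \<partial>R) = (\<integral>x. w x * cos (s * X x + 0) \<partial>R) / m"
    by (simp add: Re_exp flip: integral_divide_zero)
  have im: "(\<integral>x. Im ((w x / m) *\<^sub>R iexp (s * X x)) \<partial>R) = (\<integral>x. w x * cos (s * X x + - pi / 2) \<partial>R) / m"
    by (simp add: Im_exp cos_diff flip: integral_divide_zero)
  show "char D s = Complex ((\<integral>x. w x * cos (s * X x + 0) \<partial>R) / m) ((\<integral>x. w x * cos (s * X x + - pi / 2) \<partial>R) / m)"
    unfolding ch
    by (rule complex_eqI)
      (simp_all only: complex.sel integral_Re[OF int, symmetric] integral_Im[OF int, symmetric] re im)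
  show "measure D A = (\<integral>x. w x * indicator A (X x) \<partial>R) / m" if A [measurable]: "A \<in> sets borel"
  proof -
    interpret D: prob_space D
      using \<open>real_distribution D\<close> by (simp add: real_distribution_def)
    have "measure D A = (\<integral>x. indicator A x \<partial>D)" using A by (simp add: D)
    also have "\<dots> = (\<integral>x. indicator A (X x) \<partial>density R (\<lambda>x. ennreal (w x / m)))"
      unfolding D by (rule integral_distr) measurable
    also have "\<dots> = (\<integral>x. (w x / m) *\<^sub>R indicator A (X x) \<partial>R)"
      using w0 mpos by (intro integral_density) auto
    also have "\<dots> = (\<integral>x. w x * indicator A (X x) \<partial>R) / m"
      by (simp flip: integral_divide_zero)
    finally show ?thesis .
  qed
qed

text \<open>The one-dimensional uniqueness theorem for characteristic functions, for the laws of \<open>X\<close> under two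
  probability measures with a common bounded weight.\<close>

lemma weighted_law_unique:
  fixes X w :: "'a \<Rightarrow> real"
  assumes P: "prob_space P" "X \<in> borel_measurable P" "w \<in> borel_measurable P"
    and Q: "prob_space Q" "X \<in> borel_measurable Q" "w \<in> borel_measurable Q"
    and w: "\<And>x. 0 \<le> w x" "\<And>x. w x \<le> B"
    and eq: "\<And>s \<theta>. (\<integral>x. w x * cos (s * X x + \<theta>) \<partial>P) = (\<integral>x. w x * cos (s * X x + \<theta>) \<partial>Q)"
    and A: "A \<in> sets borel"
  shows "(\<integral>x. w x * indicator A (X x) \<partial>P) = (\<integral>x. w x * indicator A (X x) \<partial>Q)"
proof -
  define m where "m = (\<integral>x. w x \<partial>P)"
  have mP: "m = (\<integral>x. w x \<partial>P)" and mQ: "m = (\<integral>x. w x \<partial>Q)"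
    using eq[of 0 0] by (simp_all add: m_def)
  show ?thesis
  proof (cases "m = 0")
    case False
    define DP where "DP = distr (density P (\<lambda>x. ennreal (w x / m))) borel X"
    define DQ where "DQ = distr (density Q (\<lambda>x. ennreal (w x / m))) borel X"
    note wP = weighted_distr[OF P w mP False DP_def] and wQ = weighted_distr[OF Q w mQ False DQ_def]
    have "DP = DQ"
      by (rule Levy_uniqueness[OF wP(1) wQ(1)]) (rule ext, simp only: wP(2) wQ(2) eq)
    then show ?thesis
      using wP(3)[OF A] wQ(3)[OF A] False by simp
  next
    case True
    have "(\<integral>x. w x * indicator A (X x) \<partial>R) = 0"
      if "prob_space R" and [measurable]: "X \<in> borel_measurable R" "w \<in> borel_measurable R" and "(\<integral>x. w x \<partial>R) = 0" for R
    proof -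
      interpret R: prob_space R by fact
      have "integrable R w"
        using w order_trans[OF w] by (intro R.integrable_const_bound[where B = B]) auto
      then have "AE x in R. w x = 0"
        using integral_nonneg_eq_0_iff_AE[of R w] w that(4) by simp
      then have "(\<integral>x. w x * indicator A (X x) \<partial>R) = (\<integral>x. 0 \<partial>R)"
        using A by (intro integral_cong_AE) auto
      then show ?thesis by simp
    qed
    then show ?thesis
      using P Q mP mQ True by simp
  qed
qed

context interval_space
begin

text \<open>The finitely supported signed measures, viewed as linear functionals on paths.\<close>

definition point_functionals :: "((real \<Rightarrow> real) \<Rightarrow> real) set" where
  "point_functionals = {\<lambda>x. \<Sum>t\<in>F. c t * x t |F c. finite F \<and> F \<subseteq> T}"

lemma point_functional_sum: "\<lbrakk>finite F; F \<subseteq> T\<rbrakk> \<Longrightarrow> (\<lambda>x. \<Sum>t\<in>F. c t * x t) \<in> point_functionals"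
  by (auto simp: point_functionals_def)

lemma point_functional_eval: "t \<in> T \<Longrightarrow> (\<lambda>x. x t) \<in> point_functionals"
  using point_functional_sum[of "{t}" "\<lambda>_. 1"] by simp

lemma point_functional_zero: "(\<lambda>x. 0) \<in> point_functionals"
  using point_functional_sum[of "{}"] by simp

lemma point_functional_scale:
  assumes "f \<in> point_functionals" shows "(\<lambda>x. r * f x) \<in> point_functionals"
proof -
  obtain F c where "finite F" "F \<subseteq> T" and f: "f = (\<lambda>x. \<Sum>t\<in>F. c t * x t)"
    using assms by (auto simp: point_functionals_def)
  then show ?thesis
    using point_functional_sum[of F "\<lambda>t. r * c t"] by (simp add: f sum_distrib_left mult.assoc)
qed

lemma point_functional_add:
  assumes "f \<in> point_functionals" "g \<in> point_functionals"
  shows "(\<lambda>x. f x + g x) \<in> point_functionals"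
proof -
  obtain F c G d where F: "finite F" "F \<subseteq> T" and f: "f = (\<lambda>x. \<Sum>t\<in>F. c t * x t)"
    and G: "finite G" "G \<subseteq> T" and g: "g = (\<lambda>x. \<Sum>t\<in>G. d t * x t)"
    using assms by (auto simp: point_functionals_def)
  have "f x + g x = (\<Sum>t\<in>F \<union> G. ((if t \<in> F then c t else 0) + (if t \<in> G then d t else 0)) * x t)" for x
  proof -
    have "f x = (\<Sum>t\<in>F \<union> G. (if t \<in> F then c t else 0) * x t)"
      unfolding f using F G by (intro sum.mono_neutral_cong_left) auto
    moreover have "g x = (\<Sum>t\<in>F \<union> G. (if t \<in> G then d t else 0) * x t)"
      unfolding g using F G by (intro sum.mono_neutral_cong_left) auto
    ultimately show ?thesis by (simp add: sum.distrib distrib_right)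
  qed
  then show ?thesis
    using F G point_functional_sum[of "F \<union> G"] by simp
qed

lemma point_functional_diff:
  assumes "f \<in> point_functionals" "g \<in> point_functionals"
  shows "(\<lambda>x. f x - g x) \<in> point_functionals"
  using point_functional_add[OF assms(1) point_functional_scale[OF assms(2), of "-1"]] by simp

lemma point_functional_Sum:
  assumes "finite I" "\<And>i. i \<in> I \<Longrightarrow> f i \<in> point_functionals"
  shows "(\<lambda>x. \<Sum>i\<in>I. f i x) \<in> point_functionals"
  using assms by (induction I) (auto intro: point_functional_zero point_functional_add)

lemma point_functional_linear:
  assumes "f \<in> point_functionals" "\<And>t. t \<in> T \<Longrightarrow> z t = x t + r * y t"
  shows "f z = f x + r * f y"
proof -
  obtain F c where F: "finite F" "F \<subseteq> T" and f: "f = (\<lambda>x. \<Sum>t\<in>F. c t * x t)"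
    using assms by (auto simp: point_functionals_def)
  have "f z = (\<Sum>t\<in>F. c t * (x t + r * y t))"
    unfolding f using F assms(2) by (intro sum.cong) auto
  then show ?thesis
    by (simp add: f algebra_simps sum.distrib sum_distrib_left)
qed

lemma point_functional_measurable:
  assumes "f \<in> point_functionals" "\<And>t. t \<in> T \<Longrightarrow> (\<lambda>\<omega>. g \<omega> t) \<in> borel_measurable N"
  shows "(\<lambda>\<omega>. f (g \<omega>)) \<in> borel_measurable N"
proof -
  obtain F c where F: "finite F" "F \<subseteq> T" and f: "f = (\<lambda>x. \<Sum>t\<in>F. c t * x t)"
    using assms by (auto simp: point_functionals_def)
  then show ?thesis
    unfolding f using assms(2) by (intro borel_measurable_sum borel_measurable_times borel_measurable_const) auto
qed

text \<open>Two probability measures on C(T) under which all point functionals have the same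
  characteristic function agree. The coordinates are restricted one after the other: if the weight
  \<open>w\<close> is already known to be admissible, then so is \<open>w\<close> times the indicator of an event about one
  more coordinate, because \<open>w (1 + cos (f + \<theta>))\<close> is a nonnegative weight to which the
  one-dimensional uniqueness theorem applies.\<close>

lemma law_unique:
  assumes P: "prob_space P" "sets P = sets (CT_borel T)"
    and Q: "prob_space Q" "sets Q = sets (CT_borel T)"
    and eq: "\<And>f \<theta>. f \<in> point_functionals \<Longrightarrow> (\<integral>x. cos (f x + \<theta>) \<partial>P) = (\<integral>x. cos (f x + \<theta>) \<partial>Q)"
  shows "P = Q"
proof -
  interpret P: prob_space P by fact
  interpret Q: prob_space Q by fact
  have eval [measurable]: "(\<lambda>x. x t) \<in> borel_measurable P" "(\<lambda>x. x t) \<in> borel_measurable Q" if "t \<in> T" for t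
    using eval_measurable[OF that] P(2) Q(2) by (simp_all cong: measurable_cong_sets)
  have meas: "f \<in> borel_measurable P" "f \<in> borel_measurable Q" if "f \<in> point_functionals" for f
    using point_functional_measurable[OF that, of "\<lambda>x. x"] eval by auto
  have step: "(\<integral>x. (\<Prod>t\<in>F. indicator (A t) (x t)) * cos (f x + \<theta>) \<partial>P)
      = (\<integral>x. (\<Prod>t\<in>F. indicator (A t) (x t)) * cos (f x + \<theta>) \<partial>Q)"
    if "finite F" "F \<subseteq> T" "\<And>t. A t \<in> sets borel" "f \<in> point_functionals" for F A f \<theta>
    using that
  proof (induction F arbitrary: f \<theta>)
    case empty
    then show ?case by (simp add: eq)
  next
    case (insert t F)
    have t: "t \<in> T" and FT: "F \<subseteq> T" using insert.prems by auto
    note [measurable] = insert.prems(2) meas[OF insert.prems(3)] eval[OF t]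
    define w :: "(real \<Rightarrow> real) \<Rightarrow> real" where "w x = (\<Prod>t\<in>F. indicator (A t) (x t))" for x
    have w01: "0 \<le> w x" "w x \<le> 1" for x
      by (auto simp: w_def intro!: prod_nonneg prod_le_1)
    have [measurable]: "w \<in> borel_measurable P" "w \<in> borel_measurable Q"
      unfolding w_def using FT insert.prems(2)
      by (intro borel_measurable_prod measurable_compose[OF eval(1) borel_measurable_indicator]
          measurable_compose[OF eval(2) borel_measurable_indicator]; auto)+
    have IH: "(\<integral>x. w x * cos (g x + \<eta>) \<partial>P) = (\<integral>x. w x * cos (g x + \<eta>) \<partial>Q)"
      if "g \<in> point_functionals" for g \<eta>
      using insert.IH[OF FT insert.prems(2) that] by (simp add: w_def)
    have int: "integrable P (\<lambda>x. w x * g x)" if "g \<in> borel_measurable P" "\<And>x. \<bar>g x\<bar> \<le> 1" for g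
      using that w01 by (intro P.integrable_const_bound[where B = 1]) (auto simp: abs_mult intro!: mult_le_one)
    have intQ: "integrable Q (\<lambda>x. w x * g x)" if "g \<in> borel_measurable Q" "\<And>x. \<bar>g x\<bar> \<le> 1" for g
      using that w01 by (intro Q.integrable_const_bound[where B = 1]) (auto simp: abs_mult intro!: mult_le_one)
    have lin: "(\<lambda>x. s * x t) \<in> point_functionals" for s
      by (intro point_functional_scale point_functional_eval t)
    have e1: "(\<integral>x. w x * indicator (A t) (x t) \<partial>P) = (\<integral>x. w x * indicator (A t) (x t) \<partial>Q)"
      by (rule weighted_law_unique[where B = 1, OF P(1) _ _ Q(1)]) (use w01 IH[OF lin] insert.prems(2) in \<open>auto simp: t\<close>)
    define v where "v x = w x * (1 + cos (f x + \<theta>))" for x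
    have [measurable]: "v \<in> borel_measurable P" "v \<in> borel_measurable Q"
      unfolding v_def by measurable
    have "0 \<le> 1 + cos (f x + \<theta>)" for x
      using cos_ge_minus_one[of "f x + \<theta>"] by linarith
    then have v: "0 \<le> v x" "v x \<le> 2" for x
      using w01[of x] mult_mono[of "w x" 1 "1 + cos (f x + \<theta>)" 2] by (simp_all add: v_def)
    have v_cos: "v x * cos (s * x t + \<eta>) = w x * cos (s * x t + \<eta>)
        + (w x * cos ((f x + s * x t) + (\<theta> + \<eta>)) / 2 + w x * cos ((f x - s * x t) + (\<theta> - \<eta>)) / 2)" for x s \<eta>
    proof -
      have "(f x - s * x t) + (\<theta> - \<eta>) = (f x + \<theta>) - (s * x t + \<eta>)"
        "(f x + s * x t) + (\<theta> + \<eta>) = (f x + \<theta>) + (s * x t + \<eta>)" by simp_all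
      then have "cos (f x + \<theta>) * cos (s * x t + \<eta>)
          = (cos ((f x - s * x t) + (\<theta> - \<eta>)) + cos ((f x + s * x t) + (\<theta> + \<eta>))) / 2"
        by (simp only: cos_times_cos)
      then have "v x * cos (s * x t + \<eta>) = w x * cos (s * x t + \<eta>)
          + w x * ((cos ((f x - s * x t) + (\<theta> - \<eta>)) + cos ((f x + s * x t) + (\<theta> + \<eta>))) / 2)"
        unfolding v_def by (simp add: distrib_left distrib_right mult.assoc)
      then show ?thesis
        by (simp add: distrib_left add_divide_distrib)
    qed
    have e2: "(\<integral>x. v x * indicator (A t) (x t) \<partial>P) = (\<integral>x. v x * indicator (A t) (x t) \<partial>Q)"
    proof (rule weighted_law_unique[where B = 2, OF P(1) _ _ Q(1)])
      fix s \<eta>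
      have g1: "(\<lambda>x. f x + s * x t) \<in> point_functionals" and g2: "(\<lambda>x. f x - s * x t) \<in> point_functionals"
        by (intro point_functional_add point_functional_diff insert.prems lin)+
      show "(\<integral>x. v x * cos (s * x t + \<eta>) \<partial>P) = (\<integral>x. v x * cos (s * x t + \<eta>) \<partial>Q)"
        unfolding v_cos using IH[OF lin] IH[OF g1] IH[OF g2]
        by (simp add: int intQ)
    qed (use v insert.prems(2) in \<open>auto simp: t\<close>)
    have split: "w x * indicator (A t) (x t) * cos (f x + \<theta>) = v x * indicator (A t) (x t) - w x * indicator (A t) (x t)" for x
      by (simp add: v_def algebra_simps)
    have "(\<integral>x. w x * indicator (A t) (x t) * cos (f x + \<theta>) \<partial>R)
        = (\<integral>x. v x * indicator (A t) (x t) \<partial>R) - (\<integral>x. w x * indicator (A t) (x t) \<partial>R)"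
      if "prob_space R" and [measurable]: "w \<in> borel_measurable R" "v \<in> borel_measurable R" "(\<lambda>x. x t) \<in> borel_measurable R" for R
    proof -
      interpret R: prob_space R by fact
      have "integrable R (\<lambda>x. v x * indicator (A t) (x t))"
        by (rule R.integrable_const_bound[where B = 2])
          (use v insert.prems(2) in \<open>auto simp: indicator_def\<close>)
      moreover have "integrable R (\<lambda>x. w x * indicator (A t) (x t))"
        by (rule R.integrable_const_bound[where B = 1])
          (use w01 insert.prems(2) in \<open>auto simp: indicator_def\<close>)
      ultimately show ?thesis unfolding split by simp
    qed
    then have "(\<integral>x. w x * indicator (A t) (x t) * cos (f x + \<theta>) \<partial>P) = (\<integral>x. w x * indicator (A t) (x t) * cos (f x + \<theta>) \<partial>Q)"
      using e1 e2 P(1) Q(1) by (simp add: t)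
    then show ?case
      using insert.hyps by (simp add: w_def mult_ac)
  qed
  have sp: "space P = mspace (CT T)" "space Q = mspace (CT T)"
    using sets_eq_imp_space_eq[OF P(2)] sets_eq_imp_space_eq[OF Q(2)] by (simp_all add: space_CT_borel)
  show ?thesis
  proof (rule measure_eqI_generator_eq[OF Int_stable_cylinders cylinders_subset, where A = "\<lambda>_. mspace (CT T)"])
    fix C assume "C \<in> cylinders"
    then obtain F A where C: "C = {x \<in> mspace (CT T). \<forall>t\<in>F. x t \<in> A t}" "finite F" "F \<subseteq> T" "\<And>t. A t \<in> sets borel"
      unfolding cylinders_def by blast
    have Cs: "C \<in> sets (CT_borel T)"
      unfolding C(1) by (rule cylinder_in_sets[OF C(2-4)])
    have ind: "(\<Prod>t\<in>F. indicator (A t) (x t)) = (indicator C x :: real)" if "x \<in> mspace (CT T)" for x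
      using that C(2) by (auto simp: C(1) indicator_def)
    have "measure P C = (\<integral>x. indicator C x \<partial>P)"
      using Cs P(2) by simp
    also have "\<dots> = (\<integral>x. (\<Prod>t\<in>F. indicator (A t) (x t)) * cos (0 + 0) \<partial>P)"
      by (intro Bochner_Integration.integral_cong) (auto simp: ind sp)
    also have "\<dots> = (\<integral>x. (\<Prod>t\<in>F. indicator (A t) (x t)) * cos (0 + 0) \<partial>Q)"
      using step[OF C(2-4) point_functional_zero] .
    also have "\<dots> = (\<integral>x. indicator C x \<partial>Q)"
      by (intro Bochner_Integration.integral_cong) (auto simp: ind sp)
    also have "\<dots> = measure Q C"
      using Cs Q(2) by simp
    finally show "emeasure P C = emeasure Q C"
      by (simp add: P.emeasure_eq_measure Q.emeasure_eq_measure)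
  next
    show "range (\<lambda>_. mspace (CT T)) \<subseteq> cylinders"
      unfolding cylinders_def by (auto intro!: exI[of _ "{}"] exI[of _ "\<lambda>_. UNIV"])
  qed (use P(2) Q(2) sets_CT_borel_eq_cylinders in \<open>auto simp: P.emeasure_eq_measure\<close>)
qed

end

section \<open>Centered normal variables\<close>

lemma std_normal_cos:
  "(\<integral>u. cos (c * u + \<theta>) \<partial>std_normal_distribution) = exp (- c\<^sup>2 / 2) * cos \<theta>"
proof -
  interpret real_distribution std_normal_distribution by (rule real_dist_normal_dist)
  have int: "complex_integrable std_normal_distribution (\<lambda>u. iexp (c * u))"
    by (rule integrable_iexp) auto
  have "(CLINT u|std_normal_distribution. iexp (c * u)) = complex_of_real (exp (- c\<^sup>2 / 2))"
    using char_std_normal_distribution by (simp add: char_def fun_eq_iff)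
  then have c: "(\<integral>u. cos (c * u) \<partial>std_normal_distribution) = exp (- c\<^sup>2 / 2)"
    and s: "(\<integral>u. sin (c * u) \<partial>std_normal_distribution) = 0"
    using integral_Re[OF int] integral_Im[OF int] by (simp_all add: Re_exp Im_exp)
  have "integrable std_normal_distribution (\<lambda>u. cos (c * u))" "integrable std_normal_distribution (\<lambda>u. sin (c * u))"
    by (rule integrable_const_bound[where B = 1]; simp)+
  then show ?thesis
    by (simp add: cos_add c s)
qed

lemma centered_normal_facts:
  assumes M: "prob_space M" and X: "centered_normal M X"
  shows "X \<in> borel_measurable M" "integrable M (\<lambda>x. (X x)\<^sup>2)" "(\<integral>x. X x \<partial>M) = 0"
    and "(\<integral>x. cos (X x + \<theta>) \<partial>M) = exp (- (\<integral>x. (X x)\<^sup>2 \<partial>M) / 2) * cos \<theta>"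
proof -
  interpret prob_space M by (rule M)
  show meas [measurable]: "X \<in> borel_measurable M"
    using X by (simp add: centered_normal_def)
  have "integrable M (\<lambda>x. (X x)\<^sup>2) \<and> (\<integral>x. X x \<partial>M) = 0
      \<and> (\<integral>x. cos (X x + \<theta>) \<partial>M) = exp (- (\<integral>x. (X x)\<^sup>2 \<partial>M) / 2) * cos \<theta>"
  proof (cases "AE x in M. X x = 0")
    case True
    then have "(\<integral>x. cos (X x + \<theta>) \<partial>M) = (\<integral>x. cos \<theta> \<partial>M)" "(\<integral>x. (X x)\<^sup>2 \<partial>M) = (\<integral>x. 0 \<partial>M)"
      "(\<integral>x. X x \<partial>M) = (\<integral>x. 0 \<partial>M)"
      by (intro integral_cong_AE; auto)+
    moreover have "integrable M (\<lambda>x. (X x)\<^sup>2) \<longleftrightarrow> integrable M (\<lambda>x. 0 :: real)"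
      using True by (intro integrable_cong_AE) auto
    ultimately show ?thesis by (simp add: prob_space)
  next
    case False
    then obtain \<sigma> where \<sigma>: "\<sigma> > 0" and D: "distributed M lborel X (normal_density 0 \<sigma>)"
      using X by (auto simp: centered_normal_def)
    have i2: "integrable lborel (\<lambda>x. normal_density 0 \<sigma> x * x\<^sup>2)"
      using integrable_normal_moment[OF \<sigma>, of 0 2] by simp
    have "integrable M (\<lambda>x. (X x)\<^sup>2)"
      using distributed_integrable[OF D, of "\<lambda>x. x\<^sup>2"] i2 by simp
    moreover have "(\<integral>x. (X x)\<^sup>2 \<partial>M) = \<sigma>\<^sup>2"
      using distributed_integral[OF D, of "\<lambda>x. x\<^sup>2"] integral_normal_moment_even[OF \<sigma>, of 0 1] by simp
    moreover have "(\<integral>x. X x \<partial>M) = 0"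
      using distributed_integral[OF D, of "\<lambda>x. x"] integral_normal_moment_odd[OF \<sigma>, of 0 0] by simp
    moreover have "(\<integral>x. cos (X x + \<theta>) \<partial>M) = exp (- \<sigma>\<^sup>2 / 2) * cos \<theta>"
    proof -
      have "distributed M lborel (\<lambda>x. X x / \<sigma>) std_normal_density"
        using D normal_standard_normal_convert[OF \<sigma>, of X 0] by simp
      then have "distr M lborel (\<lambda>x. X x / \<sigma>) = std_normal_distribution"
        by (simp add: distributed_def)
      then have "(\<integral>u. cos (\<sigma> * u + \<theta>) \<partial>std_normal_distribution) = (\<integral>u. cos (\<sigma> * u + \<theta>) \<partial>distr M lborel (\<lambda>x. X x / \<sigma>))"
        by simp
      also have "\<dots> = (\<integral>x. cos (\<sigma> * (X x / \<sigma>) + \<theta>) \<partial>M)"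
        by (rule integral_distr) measurable
      finally show ?thesis
        using \<sigma> by (simp add: std_normal_cos)
    qed
    ultimately show ?thesis by simp
  qed
  then show "integrable M (\<lambda>x. (X x)\<^sup>2)" "(\<integral>x. X x \<partial>M) = 0"
    "(\<integral>x. cos (X x + \<theta>) \<partial>M) = exp (- (\<integral>x. (X x)\<^sup>2 \<partial>M) / 2) * cos \<theta>"
    by auto
qed

section \<open>Covariance of a centered Gaussian law\<close>

text \<open>A centered Gaussian law on C(T). Normality is only required of the point functionals.\<close>

locale gaussian_law = interval_space + prob_space P for P :: "(real \<Rightarrow> real) measure" +
  assumes sets_P: "sets P = sets (CT_borel T)"
    and gaussian: "f \<in> point_functionals \<Longrightarrow> centered_normal P f"
begin

lemma space_P: "space P = mspace (CT T)"
  using sets_eq_imp_space_eq[OF sets_P] by (simp add: space_CT_borel)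

lemma eval_measurable_P: "t \<in> T \<Longrightarrow> (\<lambda>x. x t) \<in> borel_measurable P"
  using eval_measurable[of t] sets_P by (simp cong: measurable_cong_sets)

lemma pf_measurable [measurable]: "f \<in> point_functionals \<Longrightarrow> f \<in> borel_measurable P"
  using centered_normal_facts(1)[OF prob_space_axioms gaussian] .

lemma pf_square_integrable: "f \<in> point_functionals \<Longrightarrow> integrable P (\<lambda>x. (f x)\<^sup>2)"
  using centered_normal_facts(2)[OF prob_space_axioms gaussian] .

text \<open>The covariance of two point functionals, which are centered under \<open>P\<close>.\<close>

definition cov :: "((real \<Rightarrow> real) \<Rightarrow> real) \<Rightarrow> ((real \<Rightarrow> real) \<Rightarrow> real) \<Rightarrow> real" where
  "cov f g = (\<integral>x. f x * g x \<partial>P)"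

lemma pf_centered: "f \<in> point_functionals \<Longrightarrow> (\<integral>x. f x \<partial>P) = 0"
  using centered_normal_facts(3)[OF prob_space_axioms gaussian] .

lemma pf_cos: "f \<in> point_functionals \<Longrightarrow> (\<integral>x. cos (f x + \<theta>) \<partial>P) = exp (- cov f f / 2) * cos \<theta>"
  using centered_normal_facts(4)[OF prob_space_axioms gaussian, of f \<theta>]
  by (simp add: cov_def power2_eq_square)

lemma pf_product_integrable:
  assumes "f \<in> point_functionals" "g \<in> point_functionals"
  shows "integrable P (\<lambda>x. f x * g x)"
proof (rule Bochner_Integration.integrable_bound)
  show "integrable P (\<lambda>x. (f x)\<^sup>2 + (g x)\<^sup>2)"
    using assms by (intro Bochner_Integration.integrable_add pf_square_integrable)
  have "\<bar>u * v\<bar> \<le> \<bar>u\<^sup>2 + v\<^sup>2\<bar>" for u v :: real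
  proof -
    have "2 * (\<bar>u\<bar> * \<bar>v\<bar>) \<le> u\<^sup>2 + v\<^sup>2"
      using sum_squares_bound[of "\<bar>u\<bar>" "\<bar>v\<bar>"] by simp
    moreover have "0 \<le> \<bar>u\<bar> * \<bar>v\<bar>" by simp
    ultimately show ?thesis
      unfolding abs_mult by (intro order_trans[OF _ abs_ge_self]) linarith
  qed
  then show "AE x in P. norm (f x * g x) \<le> norm ((f x)\<^sup>2 + (g x)\<^sup>2)" by simp
qed (use assms in measurable)

lemma cov_commute: "cov f g = cov g f"
  by (simp add: cov_def mult.commute)

lemma cov_linear:
  assumes "f \<in> point_functionals" "g \<in> point_functionals" "h \<in> point_functionals"
  shows "cov (\<lambda>x. f x + r * g x) h = cov f h + r * cov g h"
proof -
  have "cov (\<lambda>x. f x + r * g x) h = (\<integral>x. f x * h x + r * (g x * h x) \<partial>P)"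
    by (simp add: cov_def distrib_right mult.assoc)
  then show ?thesis
    using pf_product_integrable[OF assms(1,3)] pf_product_integrable[OF assms(2,3)] by (simp add: cov_def)
qed

lemma cov_zero [simp]: "cov (\<lambda>x. 0) h = 0"
  by (simp add: cov_def)

lemma cov_scale:
  assumes "f \<in> point_functionals" "h \<in> point_functionals"
  shows "cov (\<lambda>x. r * f x) h = r * cov f h"
  using cov_linear[OF point_functional_zero assms, of r] by simp

lemma cov_add:
  assumes "f \<in> point_functionals" "g \<in> point_functionals" "h \<in> point_functionals"
  shows "cov (\<lambda>x. f x + g x) h = cov f h + cov g h"
  using cov_linear[OF assms, of 1] by simp

lemma cov_diff:
  assumes "f \<in> point_functionals" "g \<in> point_functionals" "h \<in> point_functionals"
  shows "cov (\<lambda>x. f x - g x) h = cov f h - cov g h"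
  using cov_linear[OF assms, of "-1"] by simp

lemma cov_Sum:
  assumes "finite I" "\<And>i. i \<in> I \<Longrightarrow> f i \<in> point_functionals" "h \<in> point_functionals"
  shows "cov (\<lambda>x. \<Sum>i\<in>I. f i x) h = (\<Sum>i\<in>I. cov (f i) h)"
  using assms(1,2)
  by (induction I) (simp_all add: cov_add point_functional_Sum assms(3))

lemma cov_self_nonneg: "0 \<le> cov f f"
  by (simp add: cov_def)

lemma cov_self_eq_0_AE:
  assumes "f \<in> point_functionals" "cov f f = 0"
  shows "AE x in P. f x = 0"
  using integral_nonneg_eq_0_iff_AE[OF pf_square_integrable[OF assms(1)]] assms(2)
  by (simp add: cov_def power2_eq_square)

text \<open>The covariance function \<open>(s, t) \<mapsto> Cov (x s, x t)\<close> is continuous, because variances can be read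
  off from characteristic functions, and those depend continuously on the evaluation points.\<close>

lemma covariance_function_continuous:
  "continuous_on (T \<times> T) (\<lambda>p. cov (\<lambda>x. x (fst p)) (\<lambda>x. x (snd p)))"
proof -
  \<comment> \<open>\<open>v (s, t)\<close> is the variance of \<open>x s + x t\<close>; the covariance then follows by polarization.\<close>
  define \<phi> where "\<phi> p = (\<integral>x. cos (x (fst p) + x (snd p)) \<partial>P)" for p
  define v where "v p = - 2 * ln (\<phi> p)" for p
  have ev: "(\<lambda>x. x t) \<in> point_functionals" if "t \<in> T" for t
    using that by (rule point_functional_eval)
  have \<phi>: "\<phi> p = exp (- cov (\<lambda>x. x (fst p) + x (snd p)) (\<lambda>x. x (fst p) + x (snd p)) / 2)"
    if "p \<in> T \<times> T" for p
    using that pf_cos[of "\<lambda>x. x (fst p) + x (snd p)" 0] point_functional_add[OF ev ev, of "fst p" "snd p"]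
    by (auto simp: \<phi>_def)
  have "continuous_on (T \<times> T) \<phi>"
    unfolding continuous_on_sequentially comp_def
  proof (intro allI ballI impI)
    fix p :: "nat \<Rightarrow> real \<times> real" and l
    assume l: "l \<in> T \<times> T" and "(\<forall>n. p n \<in> T \<times> T) \<and> p \<longlonglongrightarrow> l"
    then have p: "\<And>n. p n \<in> T \<times> T" and lim: "p \<longlonglongrightarrow> l" by auto
    show "(\<lambda>n. \<phi> (p n)) \<longlonglongrightarrow> \<phi> l"
      unfolding \<phi>_def
    proof (rule integral_dominated_convergence[where w = "\<lambda>_. 1"])
      show "AE x in P. (\<lambda>n. cos (x (fst (p n)) + x (snd (p n)))) \<longlonglongrightarrow> cos (x (fst l) + x (snd l))"
      proof (rule AE_I2)
        fix x assume "x \<in> space P"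
        then have x: "continuous_on T x" by (simp add: space_P mspace_CT_cont)
        have "(\<lambda>n. x (fst (p n))) \<longlonglongrightarrow> x (fst l)" "(\<lambda>n. x (snd (p n))) \<longlonglongrightarrow> x (snd l)"
          using l p by (auto intro!: continuous_on_tendsto_compose[OF x] tendsto_fst tendsto_snd lim
              simp: mem_Times_iff)
        then show "(\<lambda>n. cos (x (fst (p n)) + x (snd (p n)))) \<longlonglongrightarrow> cos (x (fst l) + x (snd l))"
          by (intro tendsto_cos tendsto_add)
      qed
      have m: "(\<lambda>x. cos (x (fst q) + x (snd q))) \<in> borel_measurable P" if "q \<in> T \<times> T" for q
        using that eval_measurable_P[of "fst q"] eval_measurable_P[of "snd q"] by auto
      show "(\<lambda>x. cos (x (fst l) + x (snd l))) \<in> borel_measurable P"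
        "\<And>n. (\<lambda>x. cos (x (fst (p n)) + x (snd (p n)))) \<in> borel_measurable P"
        using m l p by auto
    qed auto
  qed
  then have v_cont: "continuous_on (T \<times> T) v"
    unfolding v_def by (intro continuous_intros) (auto simp: \<phi>)
  have v: "v (s, t) = cov (\<lambda>x. x s) (\<lambda>x. x s) + cov (\<lambda>x. x t) (\<lambda>x. x t) + 2 * cov (\<lambda>x. x s) (\<lambda>x. x t)"
    if "s \<in> T" "t \<in> T" for s t
  proof -
    note [simp] = ev[OF that(1)] ev[OF that(2)] point_functional_add[OF ev ev, OF that]
    have "v (s, t) = cov (\<lambda>x. x s + x t) (\<lambda>x. x s + x t)"
      using that \<phi>[of "(s, t)"] by (simp add: v_def)
    also have "\<dots> = cov (\<lambda>x. x s) (\<lambda>x. x s + x t) + cov (\<lambda>x. x t) (\<lambda>x. x s + x t)"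
      by (rule cov_add) simp_all
    also have "cov (\<lambda>x. x s) (\<lambda>x. x s + x t) = cov (\<lambda>x. x s) (\<lambda>x. x s) + cov (\<lambda>x. x s) (\<lambda>x. x t)"
      using cov_add[OF ev[OF that(1)] ev[OF that(2)] ev[OF that(1)]] by (simp add: cov_commute)
    also have "cov (\<lambda>x. x t) (\<lambda>x. x s + x t) = cov (\<lambda>x. x s) (\<lambda>x. x t) + cov (\<lambda>x. x t) (\<lambda>x. x t)"
      using cov_add[OF ev[OF that(1)] ev[OF that(2)] ev[OF that(2)]] by (simp add: cov_commute)
    finally show ?thesis by simp
  qed
  have "continuous_on (T \<times> T) (\<lambda>p. (v p - v (fst p, fst p) / 4 - v (snd p, snd p) / 4) / 2)"
    by (intro continuous_intros v_cont continuous_on_compose2[OF v_cont]) auto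
  then show ?thesis
    by (rule continuous_on_eq) (auto simp: v)
qed

text \<open>The path \<open>s \<mapsto> Cov (x s, f)\<close>, i.e. the image of the signed measure behind \<open>f\<close> under the
  covariance operator.\<close>

definition kern :: "((real \<Rightarrow> real) \<Rightarrow> real) \<Rightarrow> real \<Rightarrow> real" where
  "kern f = (\<lambda>s\<in>T. cov (\<lambda>x. x s) f)"

lemma cov_left_expand:
  assumes "finite F" "F \<subseteq> T" "f = (\<lambda>x. \<Sum>t\<in>F. c t * x t)" "h \<in> point_functionals"
  shows "cov f h = (\<Sum>t\<in>F. c t * cov (\<lambda>x. x t) h)"
proof -
  have "cov f h = (\<Sum>t\<in>F. cov (\<lambda>x. c t * x t) h)"
    unfolding assms(3) using assms
    by (intro cov_Sum) (auto intro!: point_functional_scale point_functional_eval)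
  also have "\<dots> = (\<Sum>t\<in>F. c t * cov (\<lambda>x. x t) h)"
    using assms by (intro sum.cong refl cov_scale point_functional_eval) auto
  finally show ?thesis .
qed

lemma kern_in_mspace:
  assumes "f \<in> point_functionals"
  shows "kern f \<in> mspace (CT T)"
proof -
  obtain F c where F: "finite F" "F \<subseteq> T" "f = (\<lambda>x. \<Sum>t\<in>F. c t * x t)"
    using assms by (auto simp: point_functionals_def)
  have "continuous_on T (\<lambda>s. \<Sum>t\<in>F. c t * cov (\<lambda>x. x t) (\<lambda>x. x s))"
  proof (intro continuous_intros)
    fix t assume "t \<in> F"
    then show "continuous_on T (\<lambda>s. cov (\<lambda>x. x t) (\<lambda>x. x s))"
      using F(2) continuous_on_compose2[OF covariance_function_continuous, of T "\<lambda>s. (t, s)"]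
        continuous_on_Pair[OF continuous_on_const continuous_on_id, of T t]
      by auto
  qed
  then have "continuous_on T (\<lambda>s. cov (\<lambda>x. x s) f)"
    by (rule continuous_on_eq)
      (simp add: cov_left_expand[OF F point_functional_eval, symmetric] cov_commute[of f])
  then show ?thesis
    unfolding kern_def by (rule restrict_in_mspace)
qed

lemma apply_kern:
  assumes "g \<in> point_functionals" "f \<in> point_functionals"
  shows "g (kern f) = cov g f"
proof -
  obtain F c where F: "finite F" "F \<subseteq> T" "g = (\<lambda>x. \<Sum>t\<in>F. c t * x t)"
    using assms by (auto simp: point_functionals_def)
  show ?thesis
    unfolding cov_left_expand[OF F assms(2)] using F by (auto simp: kern_def intro!: sum.cong)
qed

section \<open>The Cameron--Martin theorem for point functionals\<close>

context
  fixes e assumes e: "e \<in> point_functionals" "cov e e = 1"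
begin

text \<open>The component \<open>e x\<close> of \<open>x\<close> in the direction \<open>kern e\<close> is replaced by \<open>u\<close>, for \<open>p = (x, u)\<close>. If \<open>u\<close> is
  a standard normal variable independent of \<open>x\<close>, this does not change the law of the path. A shift
  along \<open>kern e\<close> therefore amounts to a shift of \<open>u\<close>.\<close>

definition resample :: "(real \<Rightarrow> real) \<times> real \<Rightarrow> real \<Rightarrow> real" where
  "resample p = (\<lambda>t\<in>T. fst p t + (snd p - e (fst p)) * kern e t)"

lemma resample_measurable:
  "resample \<in> measurable (P \<Otimes>\<^sub>M std_normal_distribution) (CT_borel T)"
proof (rule measurable_CT_borelI)
  fix p assume "p \<in> space (P \<Otimes>\<^sub>M std_normal_distribution)"
  then have "continuous_on T (fst p)"
    by (auto simp: space_pair_measure space_P mspace_CT_cont)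
  then show "resample p \<in> mspace (CT T)"
    unfolding resample_def
    by (intro restrict_in_mspace continuous_intros mspace_CT_cont[OF kern_in_mspace] e)
next
  fix t assume t: "t \<in> T"
  note [measurable] = eval_measurable_P[OF t] pf_measurable[OF e(1)]
  show "(\<lambda>p. resample p t) \<in> borel_measurable (P \<Otimes>\<^sub>M std_normal_distribution)"
    unfolding resample_def using t by simp
qed

lemma distr_resample: "distr (P \<Otimes>\<^sub>M std_normal_distribution) (CT_borel T) resample = P"
proof -
  interpret N: real_distribution std_normal_distribution by (rule real_dist_normal_dist)
  interpret PN: pair_prob_space P std_normal_distribution ..
  show ?thesis
  proof (rule law_unique)
    show "prob_space (distr (P \<Otimes>\<^sub>M std_normal_distribution) (CT_borel T) resample)"
      by (rule PN.prob_space_distr[OF resample_measurable])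
    fix f \<theta> assume f: "f \<in> point_functionals"
    define c where "c = cov f e"
    \<comment> \<open>\<open>g\<close> is the part of \<open>f\<close> that is uncorrelated with \<open>e\<close>; its variance is \<open>cov f f - c\<^sup>2\<close>.\<close>
    define g where "g x = f x - c * e x" for x
    have g: "g \<in> point_functionals"
      unfolding g_def by (intro point_functional_diff point_functional_scale f e)
    have f_resample: "f (resample p) = c * snd p + g (fst p)" for p
      using point_functional_linear[OF f, of "resample p" "fst p" "snd p - e (fst p)" "kern e"]
      by (simp add: resample_def apply_kern[OF f e(1)] g_def c_def algebra_simps)
    have cov_g: "cov g g = cov f f - c\<^sup>2"
    proof -
      have ce: "(\<lambda>x. c * e x) \<in> point_functionals" by (intro point_functional_scale e)
      have cov_gh: "cov g h = cov f h - c * cov e h" if h: "h \<in> point_functionals" for h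
        using cov_diff[OF f ce h] cov_scale[OF e(1) h, of c] by (simp add: g_def[abs_def])
      have "cov e g = 0"
        using cov_gh[OF e(1)] e(2) by (simp add: cov_commute[of e g] c_def)
      moreover have "cov f g = cov f f - c\<^sup>2"
        using cov_gh[OF f] by (simp add: cov_commute[of f g] cov_commute[of e f] c_def power2_eq_square)
      ultimately show ?thesis
        using cov_gh[OF g] by simp
    qed
    note [measurable] = resample_measurable pf_measurable[OF g]
    have f_meas: "f \<in> borel_measurable (CT_borel T)"
      using point_functional_measurable[OF f, of "\<lambda>x. x"] eval_measurable by auto
    have int: "integrable (P \<Otimes>\<^sub>M std_normal_distribution) (\<lambda>p. cos (c * snd p + (g (fst p) + \<theta>)))"
      by (rule PN.integrable_const_bound[where B = 1]) auto
    have "(\<integral>x. cos (f x + \<theta>) \<partial>distr (P \<Otimes>\<^sub>M std_normal_distribution) (CT_borel T) resample)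
        = (\<integral>p. cos (f (resample p) + \<theta>) \<partial>(P \<Otimes>\<^sub>M std_normal_distribution))"
      using f_meas by (intro integral_distr) auto
    also have "\<dots> = (\<integral>p. cos (c * snd p + (g (fst p) + \<theta>)) \<partial>(P \<Otimes>\<^sub>M std_normal_distribution))"
      by (simp add: f_resample add.assoc)
    also have "\<dots> = (\<integral>x. (\<integral>u. cos (c * u + (g x + \<theta>)) \<partial>std_normal_distribution) \<partial>P)"
      using PN.integral_fst'[OF int] by simp
    also have "\<dots> = exp (- c\<^sup>2 / 2) * (exp (- cov g g / 2) * cos \<theta>)"
      by (simp add: std_normal_cos pf_cos[OF g])
    also have "\<dots> = exp (- cov f f / 2) * cos \<theta>"
      by (simp add: cov_g field_simps flip: exp_add)
    finally show "(\<integral>x. cos (f x + \<theta>) \<partial>distr (P \<Otimes>\<^sub>M std_normal_distribution) (CT_borel T) resample)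
        = (\<integral>x. cos (f x + \<theta>) \<partial>P)"
      by (simp add: pf_cos[OF f])
  qed (use prob_space_axioms sets_P in auto)
qed

lemma admissible_shift_unit: "admissible_shift T P (CT_scale T c (kern e))"
proof -
  interpret N: real_distribution std_normal_distribution by (rule real_dist_normal_dist)
  interpret PN: pair_prob_space P std_normal_distribution ..
  let ?Q = "P \<Otimes>\<^sub>M std_normal_distribution" and ?h = "CT_scale T c (kern e)"
  have h: "?h \<in> mspace (CT T)"
    unfolding CT_scale_def
    by (intro restrict_in_mspace continuous_intros mspace_CT_cont kern_in_mspace e)
  have add_meas: "(\<lambda>x. CT_add T x ?h) \<in> measurable P (CT_borel T)"
    using measurable_CT_add[OF compact_T T_nonempty h] sets_P by (simp cong: measurable_cong_sets)
  have shifted: "CT_add T (resample (x, u)) ?h = resample (x, c + u)" for x u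
    by (auto simp: CT_add_def CT_scale_def resample_def algebra_simps)
  have "A \<in> null_sets (shift T P ?h)" if A: "A \<in> null_sets P" for A
  proof -
    have As: "A \<in> sets (CT_borel T)" using A sets_P by auto
    have res_Q: "{p \<in> space ?Q. resample p \<notin> A} \<in> sets ?Q"
      using resample_measurable As by measurable
    have "AE x in distr ?Q (CT_borel T) resample. x \<notin> A"
      unfolding distr_resample using A by (rule AE_not_in)
    then have "AE p in ?Q. resample p \<notin> A"
      using AE_distr_iff[OF resample_measurable, of "\<lambda>x. x \<notin> A"] As by auto
    then have "AE x in P. AE u in std_normal_distribution. resample (x, u) \<notin> A"
      by (rule PN.AE_pair)
    then have "AE x in P. AE u in std_normal_distribution. resample (x, c + u) \<notin> A"
    proof (rule AE_mp[OF _ AE_I2[OF impI]])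
      fix x assume x: "x \<in> space P" and "AE u in std_normal_distribution. resample (x, u) \<notin> A"
      \<comment> \<open>The normal density is positive, so the null sets are those of Lebesgue measure, which is
        invariant under translations.\<close>
      then have "AE u in lborel. resample (x, u) \<notin> A"
        by (simp add: AE_density normal_density_pos)
      then have "AE u in distr lborel borel ((+) c). resample (x, u) \<notin> A"
        unfolding lborel_distr_plus .
      moreover have "(\<lambda>u. resample (x, u)) \<in> measurable borel (CT_borel T)"
        using measurable_compose[OF measurable_Pair1'[OF x, of std_normal_distribution] resample_measurable]
        by simp
      then have "{u \<in> space borel. resample (x, u) \<notin> A} \<in> sets borel"
        using As by measurable
      ultimately have "AE u in lborel. resample (x, c + u) \<notin> A"
        by (subst (asm) AE_distr_iff) auto
      then show "AE u in std_normal_distribution. resample (x, c + u) \<notin> A"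
        by (auto simp: AE_density)
    qed
    then have "AE x in P. AE u in std_normal_distribution. CT_add T (resample (x, u)) ?h \<notin> A"
      by (simp add: shifted)
    moreover have m: "(\<lambda>p. CT_add T (resample p) ?h) \<in> measurable ?Q (CT_borel T)"
      by (rule measurable_compose[OF resample_measurable measurable_CT_add[OF compact_T T_nonempty h]])
    then have "{p \<in> space ?Q. CT_add T (resample p) ?h \<notin> A} \<in> sets ?Q"
      using As by measurable
    ultimately have "AE p in ?Q. CT_add T (resample p) ?h \<notin> A"
      by (intro PN.AE_pair_measure) auto
    then have "AE x in distr ?Q (CT_borel T) (\<lambda>p. CT_add T (resample p) ?h). x \<notin> A"
      using As by (subst AE_distr_iff[OF m]) auto
    moreover have "distr ?Q (CT_borel T) (\<lambda>p. CT_add T (resample p) ?h) = shift T P ?h"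
    proof -
      have "distr ?Q (CT_borel T) (\<lambda>p. CT_add T (resample p) ?h)
          = distr (distr ?Q (CT_borel T) resample) (CT_borel T) (\<lambda>x. CT_add T x ?h)"
        using distr_distr[OF measurable_CT_add[OF compact_T T_nonempty h] resample_measurable]
        by (simp add: comp_def)
      then show ?thesis by (simp add: distr_resample shift_def)
    qed
    ultimately have "AE x in shift T P ?h. x \<notin> A" by (simp only:)
    then show ?thesis
      using As AE_iff_null_sets[of A "shift T P ?h"] by (simp add: shift_def)
  qed
  then show ?thesis
    using h by (auto simp: admissible_shift_def absolutely_continuous_def)
qed

end

lemma kern_in_shift_kernel:
  assumes f: "f \<in> point_functionals"
  shows "kern f \<in> shift_kernel T P"
proof -
  have "admissible_shift T P (CT_scale T c (kern f))" for c
  proof (cases "cov f f = 0")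
    case True
    then have "AE x in P. f x = 0" by (rule cov_self_eq_0_AE[OF f])
    then have "AE x in P. x s * f x = 0" for s by auto
    then have "cov (\<lambda>x. x s) f = 0" if "s \<in> T" for s
      using integral_cong_AE[of "\<lambda>x. x s * f x" P "\<lambda>x. 0"] eval_measurable_P[OF that] pf_measurable[OF f]
      by (simp add: cov_def del: mult_eq_0_iff)
    then have zero: "CT_scale T c (kern f) = (\<lambda>t\<in>T. 0)"
      by (auto simp: CT_scale_def kern_def)
    have "CT_add T x (\<lambda>t\<in>T. 0) = x" if "x \<in> space P" for x
      using that by (auto simp: space_P CT_add_def mspace_CT_iff extensional_def)
    then have "shift T P (\<lambda>t\<in>T. 0) = distr P (CT_borel T) (\<lambda>x. x)"
      unfolding shift_def by (intro distr_cong) auto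
    also have "\<dots> = P" using sets_P by (simp add: distr_id2)
    finally show ?thesis
      unfolding zero admissible_shift_def absolutely_continuous_def
      by (simp add: restrict_in_mspace)
  next
    case False
    define r where "r = sqrt (cov f f)"
    have r: "r > 0" "r\<^sup>2 = cov f f"
      using False cov_self_nonneg[of f] by (auto simp: r_def less_le)
    define e where "e x = (1 / r) * f x" for x
    have e: "e \<in> point_functionals"
      unfolding e_def by (intro point_functional_scale f)
    have ef: "cov e g = cov f g / r" if "g \<in> point_functionals" for g
      using cov_scale[OF f that, of "1 / r"] by (simp add: e_def[abs_def])
    have "cov e e = 1"
      using ef[OF e] ef[OF f] r False cov_commute[of f e] by (simp add: power2_eq_square)
    moreover have "CT_scale T c (kern f) = CT_scale T (c * r) (kern e)"
      using r ef[OF point_functional_eval]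
      by (auto simp: CT_scale_def kern_def cov_commute[of "\<lambda>x. x t" for t])
    ultimately show ?thesis
      using admissible_shift_unit[OF e, of "c * r"] by simp
  qed
  then show ?thesis
    by (auto simp: shift_kernel_def kern_in_mspace f)
qed

end

section \<open>Discretization and modulus of continuity\<close>

lemma sum_times_delta:
  fixes c :: "nat \<Rightarrow> real"
  assumes "j < n" shows "(\<Sum>i<n. c i * (if i = j then 1 else 0)) = c j"
proof -
  have "(\<Sum>i<n. c i * (if i = j then 1 else 0)) = (\<Sum>i<n. if i = j then c i else 0)"
    by (intro sum.cong) auto
  then show ?thesis using assms by simp
qed

context interval_space
begin

lemma point_functional_combination:
  assumes "f \<in> point_functionals"
  shows "f (\<lambda>t. \<Sum>i\<in>I. r i * y i t) = (\<Sum>i\<in>I. r i * f (y i))"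
proof -
  obtain F c where F: "f = (\<lambda>x. \<Sum>t\<in>F. c t * x t)"
    using assms by (auto simp: point_functionals_def)
  have "f (\<lambda>t. \<Sum>i\<in>I. r i * y i t) = (\<Sum>t\<in>F. \<Sum>i\<in>I. r i * (c t * y i t))"
    unfolding F by (simp add: sum_distrib_left mult.left_commute)
  also have "\<dots> = (\<Sum>i\<in>I. \<Sum>t\<in>F. r i * (c t * y i t))"
    by (rule sum.swap)
  finally show ?thesis
    unfolding F by (simp add: sum_distrib_left)
qed

lemma discretization:
  assumes d: "d > 0"
  obtains p :: "real \<Rightarrow> real" where "p \<in> borel_measurable borel" "finite (p ` T)" "p ` T \<subseteq> T"
    "\<And>t. t \<in> T \<Longrightarrow> \<bar>t - p t\<bar> \<le> d"
proof -
  define p where "p t = a + d * of_int \<lfloor>(t - a) / d\<rfloor>" for t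
  have p: "p t \<le> t" "t - p t \<le> d" for t
  proof -
    have "of_int \<lfloor>(t - a) / d\<rfloor> \<le> (t - a) / d" "(t - a) / d \<le> of_int \<lfloor>(t - a) / d\<rfloor> + 1"
      by linarith+
    then have "of_int \<lfloor>(t - a) / d\<rfloor> * d \<le> t - a" "t - a \<le> (of_int \<lfloor>(t - a) / d\<rfloor> + 1) * d"
      using d by (simp_all only: pos_le_divide_eq pos_divide_le_eq)
    then show "p t \<le> t" "t - p t \<le> d"
      by (simp_all add: p_def algebra_simps)
  qed
  have "a \<le> p t" if "t \<in> T" for t
    using that d interval by (auto simp: p_def)
  then have sub: "p ` T \<subseteq> T"
    using order_trans[OF p(1)] interval by auto
  have "p ` T \<subseteq> (\<lambda>k. a + d * of_int k) ` {0..\<lfloor>(b - a) / d\<rfloor>}"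
  proof
    fix y assume "y \<in> p ` T"
    then obtain t where t: "t \<in> T" "y = p t" by blast
    have "0 \<le> \<lfloor>(t - a) / d\<rfloor>" "\<lfloor>(t - a) / d\<rfloor> \<le> \<lfloor>(b - a) / d\<rfloor>"
      using t d interval by (auto intro!: floor_mono divide_right_mono)
    then show "y \<in> (\<lambda>k. a + d * of_int k) ` {0..\<lfloor>(b - a) / d\<rfloor>}"
      unfolding t(2) p_def by (intro imageI) simp
  qed
  then have "finite (p ` T)"
    by (rule finite_subset) simp
  moreover have "p \<in> borel_measurable borel"
    unfolding p_def by measurable
  ultimately show thesis
    using sub p by (intro that[of p]) auto
qed

text \<open>The paths whose modulus of continuity at \<open>d\<close> is at most \<open>\<epsilon>\<close>; this is a closed set.\<close>

definition modulus_le :: "real \<Rightarrow> real \<Rightarrow> (real \<Rightarrow> real) set" where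
  "modulus_le d \<epsilon> = {x \<in> mspace (CT T). \<forall>s\<in>T. \<forall>t\<in>T. \<bar>s - t\<bar> \<le> d \<longrightarrow> \<bar>x s - x t\<bar> \<le> \<epsilon>}"

lemma modulus_le_sets: "modulus_le d \<epsilon> \<in> sets (CT_borel T)"
proof -
  have "openin (CT_topology T) (mspace (CT T) - modulus_le d \<epsilon>)"
    unfolding openin_CT_iff
  proof (intro conjI ballI)
    fix x assume "x \<in> mspace (CT T) - modulus_le d \<epsilon>"
    then obtain s t where st: "s \<in> T" "t \<in> T" "\<bar>s - t\<bar> \<le> d" "\<bar>x s - x t\<bar> > \<epsilon>"
      by (auto simp: modulus_le_def not_le)
    define r where "r = (\<bar>x s - x t\<bar> - \<epsilon>) / 3"
    have "y \<in> mspace (CT T) - modulus_le d \<epsilon>"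
      if y: "y \<in> mspace (CT T)" "\<forall>t\<in>T. \<bar>x t - y t\<bar> \<le> r" for y
    proof -
      have arith: "D > \<epsilon>" if "A \<le> r" "B \<le> r" "C \<le> A + D + B" "C = \<epsilon> + 3 * r" "r > 0"
        for A B C D :: real
        using that by linarith
      have "\<bar>x s - y s\<bar> \<le> r" "\<bar>x t - y t\<bar> \<le> r" using y st by auto
      moreover have "\<bar>x s - x t\<bar> \<le> \<bar>x s - y s\<bar> + \<bar>y s - y t\<bar> + \<bar>x t - y t\<bar>" by linarith
      moreover have "\<bar>x s - x t\<bar> = \<epsilon> + 3 * r" "r > 0" using st(4) by (simp_all add: r_def field_simps)
      ultimately have "\<bar>y s - y t\<bar> > \<epsilon>" by (rule arith)
      then have "\<not> \<bar>y s - y t\<bar> \<le> \<epsilon>" by simp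
      then show ?thesis
        using y(1) st(1-3) unfolding modulus_le_def by blast
    qed
    moreover have "r > 0" using st by (simp add: r_def)
    ultimately show "\<exists>r>0. \<forall>y\<in>mspace (CT T). (\<forall>t\<in>T. \<bar>x t - y t\<bar> \<le> r) \<longrightarrow> y \<in> mspace (CT T) - modulus_le d \<epsilon>"
      by blast
  qed auto
  then have "mspace (CT T) - modulus_le d \<epsilon> \<in> sets (CT_borel T)"
    by (auto simp: sets_CT_borel)
  then have "space (CT_borel T) - (mspace (CT T) - modulus_le d \<epsilon>) \<in> sets (CT_borel T)"
    by (rule sets.compl_sets)
  moreover have "modulus_le d \<epsilon> \<subseteq> mspace (CT T)"
    by (auto simp: modulus_le_def)
  ultimately show ?thesis
    by (simp add: space_CT_borel double_diff)
qed

end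

context gaussian_law
begin

lemma small_modulus:
  assumes "\<epsilon> > 0" "\<eta> > 0"
  obtains d where "d > 0" "prob (space P - modulus_le d \<epsilon>) < \<eta>"
proof -
  define A where "A n = space P - modulus_le (1 / real (Suc n)) \<epsilon>" for n
  have "decseq A"
  proof (rule decseq_SucI)
    fix n
    have "1 / real (Suc (Suc n)) \<le> 1 / real (Suc n)"
      by (intro divide_left_mono) auto
    then have "modulus_le (1 / real (Suc n)) \<epsilon> \<subseteq> modulus_le (1 / real (Suc (Suc n))) \<epsilon>"
      unfolding modulus_le_def by (blast intro: order_trans)
    then show "A (Suc n) \<subseteq> A n"
      unfolding A_def by blast
  qed
  moreover have "range A \<subseteq> sets P"
    using modulus_le_sets sets_P by (auto simp: A_def)
  ultimately have "(\<lambda>n. prob (A n)) \<longlonglongrightarrow> prob (\<Inter>n. A n)"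
    by (intro finite_Lim_measure_decseq)
  moreover have "(\<Inter>n. A n) = {}"
  proof -
    have "\<exists>n. x \<notin> A n" if "x \<in> space P" for x
    proof -
      have x: "x \<in> mspace (CT T)" using that by (simp add: space_P)
      obtain d where d: "d > 0" "\<And>s t. \<lbrakk>s \<in> T; t \<in> T; \<bar>s - t\<bar> \<le> d\<rbrakk> \<Longrightarrow> \<bar>x s - x t\<bar> \<le> \<epsilon>"
        using mspace_CT_uniformly_continuous[OF x assms(1)] by blast
      obtain n where "1 / real (Suc n) < d"
        using nat_approx_posE[OF d(1)] by blast
      then have "x \<in> modulus_le (1 / real (Suc n)) \<epsilon>"
        using d(2) x by (auto simp: modulus_le_def simp del: of_nat_Suc)
      then show ?thesis by (auto simp: A_def)
    qed
    then show ?thesis by (auto simp: A_def)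
  qed
  ultimately have "\<forall>\<^sub>F n in sequentially. prob (A n) < \<eta>"
    using assms(2) by (intro order_tendstoD) auto
  then obtain n where "prob (A n) < \<eta>"
    by (auto simp: eventually_sequentially)
  then show thesis
    by (intro that[of "1 / real (Suc n)"]) (auto simp: A_def)
qed

section \<open>The support lies in the closure of the kernel functions\<close>

text \<open>Gram--Schmidt orthonormalization of finitely many coordinates.\<close>

lemma orthonormal_coordinates:
  assumes "finite F" "F \<subseteq> T"
  shows "\<exists>n e. (\<forall>i<n. e i \<in> point_functionals) \<and>
    (\<forall>i<n. \<forall>j<n. cov (e i) (e j) = (if i = j then 1 else 0)) \<and>
    (\<forall>t\<in>F. \<exists>c. AE x in P. x t = (\<Sum>i<n::nat. c i * e i x))"
  using assms
proof (induction F)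
  case empty
  show ?case by (rule exI[of _ 0]) simp
next
  case (insert t F)
  then have t: "t \<in> T" and ev: "(\<lambda>x. x t) \<in> point_functionals"
    by (auto intro: point_functional_eval)
  from insert obtain n :: nat and e where ne: "\<forall>i<n. e i \<in> point_functionals"
    "\<forall>i<n. \<forall>j<n. cov (e i) (e j) = (if i = j then 1 else 0)"
    "\<forall>t\<in>F. \<exists>c. AE x in P. x t = (\<Sum>i<n. c i * e i x)"
    by auto
  note e = ne(1)[rule_format] and on = ne(2)[rule_format] and F = ne(3)[rule_format]
  define k where "k i = cov (\<lambda>x. x t) (e i)" for i
  define s where "s x = (\<Sum>i<n. k i * e i x)" for x
  define r where "r x = x t - s x" for x
  have s: "s \<in> point_functionals"
    unfolding s_def by (intro point_functional_Sum point_functional_scale e) auto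
  have r: "r \<in> point_functionals"
    unfolding r_def by (intro point_functional_diff ev s)
  have r_orth: "cov r (e j) = 0" if j: "j < n" for j
  proof -
    have "cov s (e j) = (\<Sum>i<n. cov (\<lambda>x. k i * e i x) (e j))"
      unfolding s_def using e j by (intro cov_Sum) (auto intro: point_functional_scale)
    also have "\<dots> = (\<Sum>i<n. k i * (if i = j then 1 else 0))"
      using e j on by (intro sum.cong) (auto simp: cov_scale)
    also have "\<dots> = k j"
      by (rule sum_times_delta[OF j])
    finally show ?thesis
      using cov_diff[OF ev s e[OF j]] by (simp add: r_def[abs_def] k_def)
  qed
  show ?case
  proof (cases "cov r r = 0")
    case True
    then have "AE x in P. r x = 0" by (rule cov_self_eq_0_AE[OF r])
    then have "AE x in P. x t = (\<Sum>i<n. k i * e i x)"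
      by (simp add: r_def s_def)
    with F have "\<forall>u\<in>insert t F. \<exists>c. AE x in P. x u = (\<Sum>i<n. c i * e i x)"
      by auto
    then show ?thesis using e on by blast
  next
    case False
    define v where "v = sqrt (cov r r)"
    have v: "v > 0" "v\<^sup>2 = cov r r"
      using False cov_self_nonneg[of r] by (auto simp: v_def less_le)
    define e' where "e' = e(n := \<lambda>x. (1 / v) * r x)"
    have new: "(\<lambda>x. (1 / v) * r x) \<in> point_functionals"
      by (intro point_functional_scale r)
    have e': "e' i \<in> point_functionals" if "i < Suc n" for i
      using that e new by (auto simp: e'_def)
    have scale: "cov (\<lambda>x. (1 / v) * r x) h = (1 / v) * cov r h" if "h \<in> point_functionals" for h
      by (rule cov_scale[OF r that])
    have "cov (\<lambda>x. (1 / v) * r x) (\<lambda>x. (1 / v) * r x) = (1 / v) * ((1 / v) * cov r r)"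
      unfolding scale[OF new] unfolding cov_commute[of r "\<lambda>x. (1 / v) * r x"] scale[OF r] ..
    also have "\<dots> = 1"
      using v by (simp flip: v(2) add: power2_eq_square)
    finally have unit: "cov (\<lambda>x. (1 / v) * r x) (\<lambda>x. (1 / v) * r x) = 1" .
    have orth: "cov (\<lambda>x. (1 / v) * r x) (e j) = 0" "cov (e j) (\<lambda>x. (1 / v) * r x) = 0" if "j < n" for j
      using scale[OF e[OF that]] r_orth[OF that] cov_commute[of "e j" "\<lambda>x. (1 / v) * r x"] by simp_all
    have on': "cov (e' i) (e' j) = (if i = j then 1 else 0)" if "i < Suc n" "j < Suc n" for i j
      using that on orth unit by (auto simp: e'_def less_Suc_eq)
    have "\<exists>c. AE x in P. x u = (\<Sum>i<Suc n. c i * e' i x)" if u: "u \<in> insert t F" for u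
    proof (cases "u = t")
      case True
      have "x t = (\<Sum>i<Suc n. (k(n := v)) i * e' i x)" for x
        using v(1) by (simp add: e'_def r_def s_def)
      then show ?thesis unfolding True by (intro exI[of _ "k(n := v)"]) simp
    next
      case False
      then obtain c where "AE x in P. x u = (\<Sum>i<n. c i * e i x)" using F u by blast
      then have "AE x in P. x u = (\<Sum>i<Suc n. (c(n := 0)) i * e' i x)"
        by (simp add: e'_def)
      then show ?thesis by blast
    qed
    then show ?thesis using e' on' by blast
  qed
qed

end

text \<open>Finitely many point functionals that are orthonormal in the space of square integrable functions
  on \<open>P\<close>.\<close>

locale orthonormal_functionals = gaussian_law +
  fixes n :: nat and e :: "nat \<Rightarrow> (real \<Rightarrow> real) \<Rightarrow> real"
  assumes e: "\<And>i. i < n \<Longrightarrow> e i \<in> point_functionals"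
    and orthonormal: "\<And>i j. \<lbrakk>i < n; j < n\<rbrakk> \<Longrightarrow> cov (e i) (e j) = (if i = j then 1 else 0)"
begin

text \<open>The conditional expectation of the path given \<open>e 0, \<dots>, e (n - 1)\<close>, i.e. its projection
  \<open>\<Sum>i<n. e i x * kern (e i)\<close>. It is written as a single kernel function, with coefficients that depend
  on the path.\<close>

definition proj :: "(real \<Rightarrow> real) \<Rightarrow> real \<Rightarrow> real" where
  "proj x = kern (\<lambda>y. \<Sum>i<n. e i x * e i y)"

lemma proj_eq: "t \<in> T \<Longrightarrow> proj x t = (\<Sum>i<n. e i x * kern (e i) t)"
proof -
  assume t: "t \<in> T"
  have "cov (\<lambda>y. \<Sum>i<n. e i x * e i y) (\<lambda>y. y t) = (\<Sum>i<n. cov (\<lambda>y. e i x * e i y) (\<lambda>y. y t))"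
    by (intro cov_Sum point_functional_scale point_functional_eval) (auto simp: e t)
  also have "\<dots> = (\<Sum>i<n. e i x * cov (e i) (\<lambda>y. y t))"
    by (intro sum.cong refl cov_scale point_functional_eval) (auto simp: e t)
  finally show ?thesis
    using t by (simp add: proj_def kern_def cov_commute[of "\<lambda>y. y t" for y])
qed

lemma proj_functional: "(\<lambda>y. \<Sum>i<n. e i x * e i y) \<in> point_functionals"
  by (intro point_functional_Sum point_functional_scale) (auto simp: e)

text \<open>The sign of the projection is reversed. This preserves the variances of all point functionals,
  hence the law.\<close>

definition reflect :: "(real \<Rightarrow> real) \<Rightarrow> real \<Rightarrow> real" where
  "reflect x = (\<lambda>t\<in>T. x t - 2 * proj x t)"

lemma reflect_measurable: "reflect \<in> measurable P (CT_borel T)"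
proof (rule measurable_CT_borelI)
  fix x assume "x \<in> space P"
  then show "reflect x \<in> mspace (CT T)"
    unfolding reflect_def proj_def
    by (intro restrict_in_mspace continuous_intros mspace_CT_cont kern_in_mspace proj_functional)
      (auto simp: space_P mspace_CT_cont)
next
  fix t assume t: "t \<in> T"
  have "(\<lambda>x. x t - 2 * (\<Sum>i<n. e i x * kern (e i) t)) \<in> borel_measurable P"
    using e t
    by (intro borel_measurable_diff borel_measurable_times borel_measurable_sum borel_measurable_const
        eval_measurable_P pf_measurable) auto
  then show "(\<lambda>x. reflect x t) \<in> borel_measurable P"
    using t by (simp add: reflect_def proj_eq)
qed

lemma distr_reflect: "distr P (CT_borel T) reflect = P"
proof (rule law_unique)
  show "prob_space (distr P (CT_borel T) reflect)"
    by (rule prob_space_distr[OF reflect_measurable])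
  fix f \<theta> assume f: "f \<in> point_functionals"
  define c where "c i = cov f (e i)" for i
  define s where "s x = (\<Sum>i<n. c i * e i x)" for x
  define g where "g x = f x + (-2) * s x" for x
  have s: "s \<in> point_functionals"
    unfolding s_def by (intro point_functional_Sum point_functional_scale e) auto
  have g: "g \<in> point_functionals"
    unfolding g_def by (intro point_functional_add point_functional_scale f s)
  have f_reflect: "f (reflect x) = g x" for x
  proof -
    have "f (reflect x) = f x + (-2) * f (\<lambda>t. \<Sum>i<n. e i x * kern (e i) t)"
      by (rule point_functional_linear[OF f]) (simp add: reflect_def proj_eq)
    also have "f (\<lambda>t. \<Sum>i<n. e i x * kern (e i) t) = (\<Sum>i<n. e i x * f (kern (e i)))"
      by (rule point_functional_combination[OF f])
    also have "\<dots> = s x"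
      unfolding s_def using e by (intro sum.cong) (auto simp: apply_kern[OF f] c_def)
    finally show ?thesis by (simp add: g_def)
  qed
  have cov_s: "cov s h = (\<Sum>i<n. c i * cov (e i) h)" if h: "h \<in> point_functionals" for h
  proof -
    have "cov s h = (\<Sum>i<n. cov (\<lambda>x. c i * e i x) h)"
      unfolding s_def using e h by (intro cov_Sum) (auto intro: point_functional_scale)
    also have "\<dots> = (\<Sum>i<n. c i * cov (e i) h)"
      using e h by (intro sum.cong) (auto simp: cov_scale)
    finally show ?thesis .
  qed
  have cov_g: "cov g h = cov f h - 2 * (\<Sum>i<n. c i * cov (e i) h)" if "h \<in> point_functionals" for h
    using cov_linear[OF f s that, of "-2"] cov_s[OF that] by (simp add: g_def[abs_def])
  have "cov (e j) g = - c j" if j: "j < n" for j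
  proof -
    have "(\<Sum>i<n. c i * cov (e i) (e j)) = (\<Sum>i<n. c i * (if i = j then 1 else 0))"
      using j by (intro sum.cong) (auto simp: orthonormal)
    then show ?thesis
      using cov_g[OF e[OF j]] sum_times_delta[OF j, of c] by (simp add: cov_commute[of "e j" g] c_def)
  qed
  then have "(\<Sum>i<n. c i * cov (e i) g) = - (\<Sum>i<n. c i * c i)"
    by (simp add: sum_negf)
  moreover have "cov f g = cov f f - 2 * (\<Sum>i<n. c i * c i)"
    using cov_g[OF f] by (simp add: cov_commute[of f g] c_def cov_commute[of "e i" f for i])
  ultimately have cov_gg: "cov g g = cov f f"
    using cov_g[OF g] by simp
  have f_meas: "f \<in> borel_measurable (CT_borel T)"
    using point_functional_measurable[OF f, of "\<lambda>x. x"] eval_measurable by auto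
  have "(\<integral>x. cos (f x + \<theta>) \<partial>distr P (CT_borel T) reflect) = (\<integral>x. cos (f (reflect x) + \<theta>) \<partial>P)"
    using f_meas by (intro integral_distr reflect_measurable) auto
  also have "\<dots> = (\<integral>x. cos (f x + \<theta>) \<partial>P)"
    by (simp add: f_reflect pf_cos[OF g] pf_cos[OF f] cov_gg)
  finally show "(\<integral>x. cos (f x + \<theta>) \<partial>distr P (CT_borel T) reflect) = (\<integral>x. cos (f x + \<theta>) \<partial>P)" .
qed (use prob_space_axioms sets_P in auto)

lemma proj_coordinate:
  assumes t: "t \<in> T" and c: "AE x in P. x t = (\<Sum>i<n. c i * e i x)"
  shows "AE x in P. proj x t = x t"
proof -
  have "kern (e j) t = c j" if j: "j < n" for j
  proof -
    have "kern (e j) t = (\<integral>x. x t * e j x \<partial>P)"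
      using t by (simp add: kern_def cov_def)
    also have "\<dots> = (\<integral>x. (\<Sum>i<n. c i * e i x) * e j x \<partial>P)"
      using c t j e
      by (intro integral_cong_AE borel_measurable_times borel_measurable_sum borel_measurable_const
          eval_measurable_P pf_measurable) auto
    also have "\<dots> = (\<Sum>i<n. cov (\<lambda>x. c i * e i x) (e j))"
      using cov_Sum[of "{..<n}" "\<lambda>i x. c i * e i x" "e j"] e j
      by (simp add: cov_def point_functional_scale)
    also have "\<dots> = (\<Sum>i<n. c i * (if i = j then 1 else 0))"
      using e j orthonormal by (intro sum.cong) (auto simp: cov_scale)
    also have "\<dots> = c j" by (rule sum_times_delta[OF j])
    finally show ?thesis .
  qed
  then have "proj x t = (\<Sum>i<n. c i * e i x)" for x
    using t by (simp add: proj_eq mult.commute)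
  then show ?thesis using c by auto
qed

end

context gaussian_law
begin

text \<open>If the conditioning functionals determine the path on a \<open>d\<close>-net, the residual \<open>x - proj x\<close>
  vanishes on that net. The residual is half the sum of \<open>x\<close> and \<open>reflect x\<close>, which have the same
  law, so that its modulus of continuity is controlled by that of \<open>x\<close>. Hence the path is uniformly
  close to kernel functions with probability close to one.\<close>

lemma supp_subset_closure_kern:
  "supp T P \<subseteq> CT_topology T closure_of (kern ` point_functionals)"
proof
  fix x0 assume x0: "x0 \<in> supp T P"
  then have x0m: "x0 \<in> mspace (CT T)" by (simp add: supp_def)
  show "x0 \<in> CT_topology T closure_of (kern ` point_functionals)"
  proof (rule ccontr)
    assume "\<not> ?thesis"
    then obtain \<delta> where \<delta>: "\<delta> > 0" and far: "\<And>f. f \<in> point_functionals \<Longrightarrow> \<exists>t\<in>T. \<bar>x0 t - kern f t\<bar> > \<delta>"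
      using x0m kern_in_mspace by (auto simp: in_closure_CT_iff not_le)
    define N where "N = Metric_space.mball (mspace (CT T)) (mdist (CT T)) x0 (\<delta> / 2)"
    have N: "openin (CT_topology T) N" "x0 \<in> N"
      using x0m \<delta> Metric_space.openin_mball[OF Metric_space_mspace_mdist]
      by (auto simp: N_def mtopology_of_def Metric_space.centre_in_mball_iff[OF Metric_space_mspace_mdist])
    have near: "\<bar>x0 t - x t\<bar> \<le> \<delta> / 2" if "x \<in> N" "t \<in> T" for x t
      using that mdist_CT_le_iff[OF x0m, of x "\<delta> / 2"]
      by (auto simp: N_def Metric_space.mball_def[OF Metric_space_mspace_mdist])
    have Ns: "N \<in> sets P" using N(1) by (auto simp: sets_P sets_CT_borel)
    have "prob N > 0"
      using x0 N by (auto simp: supp_def emeasure_eq_measure)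
    then obtain d where d: "d > 0" "prob (space P - modulus_le d (\<delta> / 3)) < prob N / 2"
      using small_modulus[of "\<delta> / 3" "prob N / 2"] \<delta> by auto
    define B where "B = space P - modulus_le d (\<delta> / 3)"
    have Bs: "B \<in> sets P" "B \<in> sets (CT_borel T)"
      using modulus_le_sets sets_P by (auto simp: B_def)
    obtain p where p: "finite (p ` T)" "p ` T \<subseteq> T" "\<And>t. t \<in> T \<Longrightarrow> \<bar>t - p t\<bar> \<le> d"
      using discretization[OF d(1)] by metis
    obtain n :: nat and e where ne: "\<forall>i<n. e i \<in> point_functionals"
      "\<forall>i<n. \<forall>j<n. cov (e i) (e j) = (if i = j then 1 else 0)"
      "\<forall>t\<in>p ` T. \<exists>c. AE x in P. x t = (\<Sum>i<n. c i * e i x)"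
      using orthonormal_coordinates[OF p(1,2)] by blast
    note e = ne(1)[rule_format] and on = ne(2)[rule_format] and F = ne(3)[rule_format]
    interpret on: orthonormal_functionals a b T P n e
      by unfold_locales (simp_all add: e on)
    note R = on.reflect_measurable on.distr_reflect
    have "AE x in P. \<forall>t\<in>p ` T. on.proj x t = x t"
    proof (intro AE_finite_allI p(1))
      fix t assume "t \<in> p ` T"
      then obtain c where "t \<in> T" "AE x in P. x t = (\<Sum>i<n. c i * e i x)" using F p(2) by blast
      then show "AE x in P. on.proj x t = x t"
        by (rule on.proj_coordinate)
    qed
    then have "AE x in P. x \<in> N \<longrightarrow> x \<in> B \<union> (on.reflect -` B \<inter> space P)"
    proof (rule AE_mp[OF _ AE_I2[OF impI]])
      fix x assume x: "x \<in> space P" and grid: "\<forall>t\<in>p ` T. on.proj x t = x t"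
      show "x \<in> N \<longrightarrow> x \<in> B \<union> (on.reflect -` B \<inter> space P)"
      proof (rule impI, rule ccontr)
        assume xN: "x \<in> N" and "x \<notin> B \<union> (on.reflect -` B \<inter> space P)"
        then have "x \<in> modulus_le d (\<delta> / 3)" "on.reflect x \<in> modulus_le d (\<delta> / 3)"
          using x measurable_space[OF R(1) x] by (auto simp: B_def space_P space_CT_borel)
        then have mod: "\<bar>x s - x t\<bar> \<le> \<delta> / 3" "\<bar>(x s - 2 * on.proj x s) - (x t - 2 * on.proj x t)\<bar> \<le> \<delta> / 3"
          if "s \<in> T" "t \<in> T" "\<bar>s - t\<bar> \<le> d" for s t
          using that by (auto simp: modulus_le_def on.reflect_def)
        obtain t where t: "t \<in> T" "\<bar>x0 t - on.proj x t\<bar> > \<delta>"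
          using far[OF on.proj_functional[of x]] unfolding on.proj_def by auto
        have "p t \<in> T" "on.proj x (p t) = x (p t)"
          using grid t p by auto
        then have "\<bar>x t - on.proj x t\<bar> \<le> \<delta> / 3"
          using mod[OF t(1) \<open>p t \<in> T\<close> p(3)[OF t(1)]] by linarith
        then show False
          using near[OF xN t(1)] t(2) \<delta> by linarith
      qed
    qed
    then have "prob N \<le> prob (B \<union> (on.reflect -` B \<inter> space P))"
      using Bs measurable_sets[OF R(1) Bs(2)] by (intro finite_measure_mono_AE) auto
    also have "\<dots> \<le> prob B + prob (on.reflect -` B \<inter> space P)"
      using Bs measurable_sets[OF R(1) Bs(2)] by (intro measure_Un_le) auto
    also have "prob (on.reflect -` B \<inter> space P) = prob B"
      using measure_distr[OF R(1) Bs(2)] by (simp add: R(2))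
    finally show False using d(2) by (simp add: B_def)
  qed
qed

section \<open>The support and the shift kernel\<close>

lemma openin_translate:
  assumes N: "openin (CT_topology T) N" and h: "h \<in> mspace (CT T)"
  shows "openin (CT_topology T) {x \<in> mspace (CT T). CT_add T x h \<in> N}"
  unfolding openin_CT_iff
proof (intro conjI ballI)
  fix x assume "x \<in> {x \<in> mspace (CT T). CT_add T x h \<in> N}"
  then obtain r where r: "r > 0"
    "\<And>y. \<lbrakk>y \<in> mspace (CT T); \<forall>t\<in>T. \<bar>CT_add T x h t - y t\<bar> \<le> r\<rbrakk> \<Longrightarrow> y \<in> N"
    using N unfolding openin_CT_iff by blast
  have "CT_add T y h \<in> N" if "y \<in> mspace (CT T)" "\<forall>t\<in>T. \<bar>x t - y t\<bar> \<le> r" for y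
    using that by (intro r CT_add_mem[OF compact_T _ h]) (auto simp: CT_add_def)
  then show "\<exists>r>0. \<forall>y\<in>mspace (CT T). (\<forall>t\<in>T. \<bar>x t - y t\<bar> \<le> r) \<longrightarrow> y \<in> {x \<in> mspace (CT T). CT_add T x h \<in> N}"
    using r(1) by auto
qed auto

lemma supp_add_shift_kernel:
  assumes x: "x \<in> supp T P" and h: "h \<in> shift_kernel T P"
  shows "CT_add T x h \<in> supp T P"
proof -
  have hm: "h \<in> mspace (CT T)" using h by (simp add: shift_kernel_def)
  have "CT_scale T 1 h = h"
    using hm by (auto simp: CT_scale_def mspace_CT_iff extensional_def)
  then have adm: "absolutely_continuous P (shift T P h)"
    using h unfolding shift_kernel_def admissible_shift_def by (metis (mono_tags, lifting) mem_Collect_eq)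
  have xm: "x \<in> mspace (CT T)" using x by (simp add: supp_def)
  have "emeasure P N > 0" if N: "openin (CT_topology T) N" "CT_add T x h \<in> N" for N
  proof (rule ccontr)
    assume "\<not> emeasure P N > 0"
    moreover have Ns: "N \<in> sets (CT_borel T)" using N(1) by (auto simp: sets_CT_borel)
    ultimately have "N \<in> null_sets P" by (simp add: null_sets_def sets_P)
    then have "emeasure (shift T P h) N = 0"
      using adm by (auto simp: absolutely_continuous_def)
    moreover have "(\<lambda>x. CT_add T x h) \<in> measurable P (CT_borel T)"
      using measurable_CT_add[OF compact_T T_nonempty hm] sets_P by (simp cong: measurable_cong_sets)
    ultimately have "emeasure P ((\<lambda>x. CT_add T x h) -` N \<inter> space P) = 0"
      using Ns by (simp add: shift_def emeasure_distr)
    moreover have "(\<lambda>x. CT_add T x h) -` N \<inter> space P = {x \<in> mspace (CT T). CT_add T x h \<in> N}"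
      by (auto simp: space_P)
    ultimately show False
      using x openin_translate[OF N(1) hm] N(2) xm by (auto simp: supp_def)
  qed
  then show ?thesis
    using CT_add_mem[OF compact_T xm hm] by (simp add: supp_def)
qed

lemma supp_closed: "CT_topology T closure_of supp T P \<subseteq> supp T P"
proof
  fix x assume x: "x \<in> CT_topology T closure_of supp T P"
  have "emeasure P N > 0" if N: "openin (CT_topology T) N" "x \<in> N" for N
    using x N unfolding in_closure_of supp_def by auto
  then show "x \<in> supp T P"
    using x by (auto simp: in_closure_CT_iff supp_def)
qed

text \<open>The support contains some \<open>x\<close>, which is a limit of kernel functions. It is invariant under
  translations by kernel functions, so zero is a limit of points of the support.\<close>

lemma zero_in_supp: "(\<lambda>t\<in>T. 0) \<in> supp T P"
proof -
  have "supp T P \<noteq> {}"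
    by (rule supp_nonempty[OF sets_P]) (simp add: emeasure_space_1)
  then obtain x where x: "x \<in> supp T P" by blast
  then have xc: "x \<in> CT_topology T closure_of (kern ` point_functionals)"
    using supp_subset_closure_kern by blast
  have "\<exists>y\<in>supp T P \<inter> mspace (CT T). \<forall>t\<in>T. \<bar>(\<lambda>t\<in>T. 0) t - y t\<bar> \<le> r" if r: "r > 0" for r
  proof -
    obtain f where f: "f \<in> point_functionals" "\<And>t. t \<in> T \<Longrightarrow> \<bar>x t - kern f t\<bar> \<le> r"
      using xc r unfolding in_closure_CT_iff by blast
    define g where "g x = (-1) * f x" for x
    have g: "g \<in> point_functionals"
      unfolding g_def by (intro point_functional_scale f)
    have "kern g t = - kern f t" if "t \<in> T" for t
      using cov_scale[OF f(1) point_functional_eval[OF that], of "-1"] that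
      by (simp add: kern_def g_def[abs_def] cov_commute[of "\<lambda>x. x t"])
    then have "\<bar>(\<lambda>t\<in>T. 0) t - CT_add T x (kern g) t\<bar> \<le> r" if "t \<in> T" for t
      using f(2)[OF that] that by (simp add: CT_add_def abs_minus_commute)
    moreover have "CT_add T x (kern g) \<in> supp T P"
      by (rule supp_add_shift_kernel[OF x kern_in_shift_kernel[OF g]])
    ultimately show ?thesis
      by (intro bexI[of _ "CT_add T x (kern g)"]) (auto simp: supp_def)
  qed
  then have "(\<lambda>t\<in>T. 0) \<in> CT_topology T closure_of supp T P"
    by (auto simp: in_closure_CT_iff restrict_in_mspace)
  then show ?thesis using supp_closed by blast
qed

lemma closure_kern_shift_kernel_supp:
  "CT_topology T closure_of (kern ` point_functionals) = supp T P"
  "CT_topology T closure_of (shift_kernel T P) = supp T P"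
proof -
  have "h \<in> supp T P" if h: "h \<in> shift_kernel T P" for h
  proof -
    have "CT_add T (\<lambda>t\<in>T. 0) h = h"
      using h by (auto simp: CT_add_def shift_kernel_def mspace_CT_iff extensional_def)
    then show ?thesis
      using supp_add_shift_kernel[OF zero_in_supp h] by simp
  qed
  then have "CT_topology T closure_of (shift_kernel T P) \<subseteq> CT_topology T closure_of supp T P"
    by (intro closure_of_mono) auto
  moreover have "CT_topology T closure_of (kern ` point_functionals) \<subseteq> CT_topology T closure_of (shift_kernel T P)"
    using kern_in_shift_kernel by (intro closure_of_mono) auto
  ultimately show "CT_topology T closure_of (kern ` point_functionals) = supp T P"
    "CT_topology T closure_of (shift_kernel T P) = supp T P"
    using supp_closed supp_subset_closure_kern by auto
qed

end

section \<open>Finite signed measures\<close>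

lemma signed_measures_uminus: "\<mu> \<in> signed_measures T \<Longrightarrow> (\<lambda>A. - \<mu> A) \<in> signed_measures T"
  by (simp add: signed_measures_def sums_minus)

context
  fixes T :: "real set" and \<mu> :: "real set \<Rightarrow> real"
  assumes \<mu>: "\<mu> \<in> signed_measures T"
begin

lemma signed_measure_sums:
  fixes A :: "nat \<Rightarrow> real set"
  assumes "\<And>i. A i \<in> sets (restrict_space borel T)" "disjoint_family A"
  shows "(\<lambda>i. \<mu> (A i)) sums \<mu> (\<Union>i. A i)"
  using \<mu> assms by (auto simp: signed_measures_def)

lemma signed_measure_empty: "\<mu> {} = 0"
proof -
  have "(\<lambda>i :: nat. \<mu> {}) sums \<mu> {}"
    using signed_measure_sums[of "\<lambda>_. {}"] by (simp add: disjoint_family_on_def)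
  then have "(\<lambda>i :: nat. \<mu> {}) \<longlonglongrightarrow> 0"
    by (intro summable_LIMSEQ_zero sums_summable)
  then show ?thesis
    by (simp add: LIMSEQ_const_iff)
qed

lemma signed_measure_Un:
  assumes "A \<in> sets (restrict_space borel T)" "B \<in> sets (restrict_space borel T)" "A \<inter> B = {}"
  shows "\<mu> (A \<union> B) = \<mu> A + \<mu> B"
proof -
  have "(\<lambda>i. \<mu> (binaryset A B i)) sums \<mu> (\<Union>i. binaryset A B i)"
    using assms by (intro signed_measure_sums) (auto simp: binaryset_def disjoint_family_on_def)
  moreover have "(\<lambda>i. \<mu> (binaryset A B i)) sums (\<mu> A + \<mu> B)"
    by (rule binaryset_sums[where f = \<mu>, OF signed_measure_empty])
  ultimately show ?thesis
    by (simp add: UN_binaryset_eq sums_unique2)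
qed

text \<open>A finite signed measure is bounded. Otherwise one can successively split off sets
  of absolute measure at least one, always keeping a remainder with subsets of
  arbitrarily large absolute measure; this contradicts countable additivity.\<close>

lemma signed_measure_bounded: "\<exists>C. \<forall>A \<in> sets (restrict_space borel T). \<bar>\<mu> A\<bar> \<le> C"
proof (rule ccontr)
  let ?S = "sets (restrict_space borel T)"
  assume unbounded: "\<not> ?thesis"
  define U where "U A \<longleftrightarrow> A \<in> ?S \<and> (\<forall>C. \<exists>B\<in>?S. B \<subseteq> A \<and> \<bar>\<mu> B\<bar> > C)" for A
  have "T \<in> ?S" using sets.top[of "restrict_space borel T"] by (simp add: space_restrict_space)
  moreover have "B \<subseteq> T" if "B \<in> ?S" for B
    using sets.sets_into_space[OF that] by (simp add: space_restrict_space)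
  ultimately have "U T"
    using unbounded unfolding U_def by (meson not_le)
  have step: "\<exists>A'. U A' \<and> A' \<subseteq> A \<and> \<bar>\<mu> (A - A')\<bar> \<ge> 1" if "U A" for A
  proof -
    have A: "A \<in> ?S" using that by (simp add: U_def)
    obtain B where B: "B \<in> ?S" "B \<subseteq> A" "\<bar>\<mu> B\<bar> > \<bar>\<mu> A\<bar> + 1"
      using \<open>U A\<close> unfolding U_def by blast
    have AB: "A - B \<in> ?S" using A B by auto
    have "\<mu> A = \<mu> B + \<mu> (A - B)"
      using signed_measure_Un[OF B(1) AB] B(2) by (simp add: Un_absorb1)
    then have big: "\<bar>\<mu> (A - B)\<bar> \<ge> 1" "\<bar>\<mu> B\<bar> \<ge> 1" using B(3) by linarith+
    have "U B \<or> U (A - B)"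
    proof (rule ccontr)
      assume "\<not> (U B \<or> U (A - B))"
      then obtain C1 C2 where C: "\<And>D. \<lbrakk>D \<in> ?S; D \<subseteq> B\<rbrakk> \<Longrightarrow> \<bar>\<mu> D\<bar> \<le> C1"
        "\<And>D. \<lbrakk>D \<in> ?S; D \<subseteq> A - B\<rbrakk> \<Longrightarrow> \<bar>\<mu> D\<bar> \<le> C2"
        using B(1) AB unfolding U_def by (meson not_le)
      obtain D where D: "D \<in> ?S" "D \<subseteq> A" "\<bar>\<mu> D\<bar> > C1 + C2"
        using \<open>U A\<close> unfolding U_def by blast
      have DB: "D \<inter> B \<in> ?S" "D - B \<in> ?S" using D B by auto
      have "\<mu> D = \<mu> (D \<inter> B) + \<mu> (D - B)"
        using signed_measure_Un[OF DB] by (simp add: Int_Diff_Un Int_Diff_disjoint)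
      moreover have "\<bar>\<mu> (D \<inter> B)\<bar> \<le> C1" "\<bar>\<mu> (D - B)\<bar> \<le> C2"
        using C(1)[OF DB(1)] C(2)[OF DB(2)] D(2) by auto
      ultimately show False using D(3) by linarith
    qed
    then show ?thesis
    proof
      assume "U B" then show ?thesis using B(2) big by blast
    next
      assume "U (A - B)"
      moreover have "A - (A - B) = B" using B(2) by auto
      ultimately show ?thesis using big by (intro exI[of _ "A - B"]) auto
    qed
  qed
  obtain A where A: "\<forall>n. U (A n) \<and> (A (Suc n) \<subseteq> A n \<and> \<bar>\<mu> (A n - A (Suc n))\<bar> \<ge> 1)"
    using dependent_nat_choice[of "\<lambda>_. U" "\<lambda>_ A A'. A' \<subseteq> A \<and> \<bar>\<mu> (A - A')\<bar> \<ge> 1"] \<open>U T\<close> step by blast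
  define D where "D n = A n - A (Suc n)" for n
  have "decseq A" using A by (intro decseq_SucI) auto
  have "disjoint_family D"
  proof -
    have "D m \<inter> D n = {}" if "m < n" for m n
      using decseqD[OF \<open>decseq A\<close>, of "Suc m" n] that by (auto simp: D_def)
    then show ?thesis
      unfolding disjoint_family_on_def by (metis Int_commute linorder_neqE_nat)
  qed
  moreover have "D n \<in> ?S" for n
    using A by (auto simp: D_def U_def)
  ultimately have "(\<lambda>n. \<mu> (D n)) \<longlonglongrightarrow> 0"
    by (intro summable_LIMSEQ_zero sums_summable[OF signed_measure_sums[of D]])
  then have "\<forall>\<^sub>F n in sequentially. \<bar>\<mu> (D n)\<bar> < 1"
    using order_tendstoD(2)[OF tendsto_rabs, of "\<lambda>n. \<mu> (D n)" 0 sequentially 1] by simp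
  then obtain n where "\<bar>\<mu> (D n)\<bar> < 1"
    by (auto simp: eventually_sequentially)
  then show False using A by (auto simp: D_def not_le[symmetric])
qed

lemma space_upper_variation: "space (upper_variation T \<mu>) = T"
  and sets_upper_variation: "sets (upper_variation T \<mu>) = sets (restrict_space borel T)"
proof -
  have sub: "sets (restrict_space borel T) \<subseteq> Pow T"
    using sets.space_closed[of "restrict_space borel T"] by (simp add: space_restrict_space)
  show "space (upper_variation T \<mu>) = T"
    unfolding upper_variation_def by (rule space_measure_of[OF sub])
  show "sets (upper_variation T \<mu>) = sets (restrict_space borel T)"
    unfolding upper_variation_def sets_measure_of[OF sub]
    using sets.sigma_sets_eq[of "restrict_space borel T"] by (simp add: space_restrict_space)
qed

text \<open>Boundedness suffices here: a set function that is not a measure is turned by \<open>measure_of\<close> into the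
  zero measure.\<close>

lemma finite_measure_upper_variation: "finite_measure (upper_variation T \<mu>)"
proof (rule finite_measureI)
  obtain C where C: "\<And>A. A \<in> sets (restrict_space borel T) \<Longrightarrow> \<bar>\<mu> A\<bar> \<le> C"
    using signed_measure_bounded by blast
  have "(SUP B \<in> {B \<in> sets (restrict_space borel T). B \<subseteq> T}. ennreal (\<mu> B)) \<le> ennreal C"
    using C by (intro SUP_least ennreal_leI) (auto dest: abs_le_D1)
  then have "emeasure (upper_variation T \<mu>) T \<le> ennreal C"
    unfolding upper_variation_def emeasure_measure_of_conv by simp
  then show "emeasure (upper_variation T \<mu>) (space (upper_variation T \<mu>)) \<noteq> \<infinity>"
    unfolding space_upper_variation by (auto simp: top_unique)
qed

end

text \<open>The upper variation of a finite combination of Dirac measures is the combination with the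
  positive parts of the coefficients.\<close>

lemma upper_variation_point:
  assumes F: "finite F" "F \<subseteq> T"
  shows "upper_variation T (\<lambda>A. \<Sum>t\<in>F \<inter> A. c t)
    = distr (point_measure F (\<lambda>t. ennreal (max 0 (c t)))) (restrict_space borel T) (\<lambda>t. t)"
    (is "_ = ?D")
proof -
  let ?S = "sets (restrict_space borel T)"
  have id: "(\<lambda>t. t) \<in> measurable (point_measure F (\<lambda>t. ennreal (max 0 (c t)))) (restrict_space borel T)"
    using F by (auto simp: measurable_point_measure_eq1 space_restrict_space)
  have sp: "space ?D = T" "sets ?D = ?S"
    by (simp_all add: space_restrict_space)
  have eq: "(SUP B \<in> {B \<in> ?S. B \<subseteq> A}. ennreal (\<Sum>t\<in>F \<inter> B. c t)) = emeasure ?D A" if A: "A \<in> ?S" for A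
  proof -
    have "emeasure ?D A = emeasure (point_measure F (\<lambda>t. ennreal (max 0 (c t)))) (F \<inter> A)"
      unfolding emeasure_distr[OF id A] by (simp add: space_point_measure Int_commute)
    also have "\<dots> = (\<Sum>t\<in>F \<inter> A. ennreal (max 0 (c t)))"
      using F by (intro emeasure_point_measure_finite) auto
    also have "\<dots> = ennreal (\<Sum>t\<in>F \<inter> A. max 0 (c t))"
      by (rule sum_ennreal) simp
    finally have D: "emeasure ?D A = ennreal (\<Sum>t\<in>F \<inter> A. max 0 (c t))" .
    show ?thesis
    proof (rule antisym)
      show "(SUP B \<in> {B \<in> ?S. B \<subseteq> A}. ennreal (\<Sum>t\<in>F \<inter> B. c t)) \<le> emeasure ?D A"
        unfolding D
      proof (intro SUP_least ennreal_leI)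
        fix B assume B: "B \<in> {B \<in> ?S. B \<subseteq> A}"
        have "(\<Sum>t\<in>F \<inter> B. c t) \<le> (\<Sum>t\<in>F \<inter> B. max 0 (c t))"
          by (intro sum_mono) auto
        also have "\<dots> \<le> (\<Sum>t\<in>F \<inter> A. max 0 (c t))"
          using F B by (intro sum_mono2) auto
        finally show "(\<Sum>t\<in>F \<inter> B. c t) \<le> (\<Sum>t\<in>F \<inter> A. max 0 (c t))" .
      qed
      let ?B = "{t \<in> F \<inter> A. c t > 0}"
      have "finite ?B" using F by auto
      then have "?B \<in> sets borel" by (rule finite_imp_closed[THEN borel_closed])
      then have "T \<inter> ?B \<in> ?S" by (auto simp: sets_restrict_space)
      moreover have "T \<inter> ?B = ?B" using F by auto
      ultimately have "?B \<in> {B \<in> ?S. B \<subseteq> A}" by auto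
      moreover have "(\<Sum>t\<in>F \<inter> ?B. c t) = (\<Sum>t\<in>F \<inter> A. max 0 (c t))"
        using F by (intro sum.mono_neutral_cong_left) auto
      ultimately show "emeasure ?D A \<le> (SUP B \<in> {B \<in> ?S. B \<subseteq> A}. ennreal (\<Sum>t\<in>F \<inter> B. c t))"
        unfolding D by (intro SUP_upper2[of ?B]) auto
    qed
  qed
  have "upper_variation T (\<lambda>A. \<Sum>t\<in>F \<inter> A. c t) = measure_of T ?S (emeasure ?D)"
    unfolding upper_variation_def
  proof (rule measure_of_eq)
    show "?S \<subseteq> Pow T"
      using sets.space_closed[of "restrict_space borel T"] by (simp add: space_restrict_space)
    have "sigma_sets T ?S = ?S"
      using sets.sigma_sets_eq[of "restrict_space borel T"] by (simp add: space_restrict_space)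
    then show "(SUP B \<in> {B \<in> ?S. B \<subseteq> A}. ennreal (\<Sum>t\<in>F \<inter> B. c t)) = emeasure ?D A"
      if "A \<in> sigma_sets T ?S" for A
      using that eq by simp
  qed
  also have "\<dots> = ?D"
    using measure_of_of_measure[of ?D] by (simp only: sp)
  finally show ?thesis .
qed

lemma signed_integral_point:
  assumes F: "finite F" "F \<subseteq> T" and x: "continuous_on T x"
  shows "signed_integral T (\<lambda>A. \<Sum>t\<in>F \<inter> A. c t) x = (\<Sum>t\<in>F. c t * x t)"
proof -
  have int: "integral\<^sup>L (upper_variation T (\<lambda>A. \<Sum>t\<in>F \<inter> A. k t)) x = (\<Sum>t\<in>F. max 0 (k t) * x t)" for k
  proof -
    have id: "(\<lambda>t. t) \<in> measurable (point_measure F (\<lambda>t. ennreal (max 0 (k t)))) (restrict_space borel T)"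
      using F by (auto simp: measurable_point_measure_eq1 space_restrict_space)
    have "integral\<^sup>L (upper_variation T (\<lambda>A. \<Sum>t\<in>F \<inter> A. k t)) x
        = integral\<^sup>L (point_measure F (\<lambda>t. ennreal (max 0 (k t)))) x"
      unfolding upper_variation_point[OF F]
      using integral_distr[OF id borel_measurable_continuous_on_restrict[OF x]] by simp
    then show ?thesis
      using lebesgue_integral_point_measure_finite[OF F(1), of "\<lambda>t. max 0 (k t)" x] by simp
  qed
  have "signed_integral T (\<lambda>A. \<Sum>t\<in>F \<inter> A. c t) x = (\<Sum>t\<in>F. max 0 (c t) * x t) - (\<Sum>t\<in>F. max 0 (- c t) * x t)"
    unfolding signed_integral_def by (simp add: int flip: sum_negf)
  also have "\<dots> = (\<Sum>t\<in>F. c t * x t)"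
    unfolding sum_subtractf[symmetric] by (intro sum.cong) (auto simp: max_def)
  finally show ?thesis .
qed

lemma point_signed_measure:
  assumes "finite F"
  shows "(\<lambda>A. \<Sum>t\<in>F \<inter> A. c t) \<in> signed_measures T"
  unfolding signed_measures_def
proof (intro CollectI allI impI)
  fix A :: "nat \<Rightarrow> real set"
  assume disj: "disjoint_family A"
  have restrict: "(\<Sum>t\<in>F \<inter> B. c t) = (\<Sum>t\<in>F. if t \<in> B then c t else 0)" for B
    using assms by (rule sum.inter_restrict)
  have "(\<lambda>i. if t \<in> A i then c t else 0) sums (if t \<in> (\<Union>i. A i) then c t else 0)" for t
  proof (cases "t \<in> (\<Union>i. A i)")
    case True
    then obtain k where k: "t \<in> A k" by blast
    then have "t \<in> A i \<longleftrightarrow> i = k" for i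
      using disj by (auto simp: disjoint_family_on_def)
    then show ?thesis using True sums_single[of k "\<lambda>_. c t"] by simp
  qed simp
  then show "(\<lambda>i. \<Sum>t\<in>F \<inter> A i. c t) sums (\<Sum>t\<in>F \<inter> (\<Union>i. A i). c t)"
    unfolding restrict by (intro sums_sum)
qed

context interval_space
begin

text \<open>The integral against a finite measure is uniformly approximated by a point functional, on all
  continuous functions with a given modulus of continuity.\<close>

lemma integral_discretization:
  assumes V: "finite_measure V" "space V = T" "sets V = sets (restrict_space borel T)"
    and p: "p \<in> borel_measurable borel" "finite (p ` T)" "p ` T \<subseteq> T" "\<And>t. t \<in> T \<Longrightarrow> \<bar>t - p t\<bar> \<le> d"
    and x: "continuous_on T x" "\<And>s t. \<lbrakk>s \<in> T; t \<in> T; \<bar>s - t\<bar> \<le> d\<rbrakk> \<Longrightarrow> \<bar>x s - x t\<bar> \<le> \<epsilon>"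
  shows "\<bar>(\<integral>t. x t \<partial>V) - (\<Sum>k\<in>p ` T. measure V (p -` {k} \<inter> T) * x k)\<bar> \<le> \<epsilon> * measure V T"
proof -
  interpret finite_measure V by fact
  have meas: "f \<in> borel_measurable V" if "f \<in> borel_measurable (restrict_space borel T)" for f :: "real \<Rightarrow> real"
    using that V(3) by (simp cong: measurable_cong_sets)
  have x_int: "integrable V x"
  proof -
    have "bounded (x ` T)"
      using x(1) compact_T by (intro compact_imp_bounded compact_continuous_image)
    then obtain B where "\<And>t. t \<in> T \<Longrightarrow> \<bar>x t\<bar> \<le> B"
      by (auto simp: bounded_iff)
    then show ?thesis
      using x(1) V(2)
      by (intro integrable_const_bound[where B = B] meas borel_measurable_continuous_on_restrict) auto
  qed
  have p_meas: "p \<in> borel_measurable V"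
    using p(1) by (intro meas measurable_restrict_space1)
  have pk: "p -` {k} \<inter> T \<in> sets V" for k
    using measurable_sets[OF p_meas, of "{k}"] V(2) by simp
  have xp: "x (p t) = (\<Sum>k\<in>p ` T. x k * indicator (p -` {k} \<inter> T) t)" if t: "t \<in> T" for t
  proof -
    have "(\<Sum>k\<in>p ` T. x k * indicator (p -` {k} \<inter> T) t) = (\<Sum>k\<in>p ` T. if k = p t then x k else 0)"
      using t by (intro sum.cong) (auto simp: indicator_def)
    then show ?thesis using p(2) t by simp
  qed
  have xp_int: "integrable V (\<lambda>t. x (p t))" "(\<integral>t. x (p t) \<partial>V) = (\<Sum>k\<in>p ` T. measure V (p -` {k} \<inter> T) * x k)"
  proof -
    have "integrable V (\<lambda>t. \<Sum>k\<in>p ` T. x k * indicator (p -` {k} \<inter> T) t)"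
      using pk by (intro Bochner_Integration.integrable_sum integrable_mult_right integrable_real_indicator)
        (auto simp: emeasure_eq_measure)
    moreover have "integrable V (\<lambda>t. x (p t))
        \<longleftrightarrow> integrable V (\<lambda>t. \<Sum>k\<in>p ` T. x k * indicator (p -` {k} \<inter> T) t)"
      by (intro Bochner_Integration.integrable_cong refl) (simp add: xp V(2))
    ultimately show "integrable V (\<lambda>t. x (p t))" by simp
    have "(\<integral>t. x (p t) \<partial>V) = (\<integral>t. (\<Sum>k\<in>p ` T. x k * indicator (p -` {k} \<inter> T) t) \<partial>V)"
      using xp V(2) by (intro Bochner_Integration.integral_cong) auto
    also have "\<dots> = (\<Sum>k\<in>p ` T. \<integral>t. x k * indicator (p -` {k} \<inter> T) t \<partial>V)"
      using pk by (intro Bochner_Integration.integral_sum integrable_mult_right integrable_real_indicator)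
        (auto simp: emeasure_eq_measure)
    also have "\<dots> = (\<Sum>k\<in>p ` T. measure V (p -` {k} \<inter> T) * x k)"
      using V(2) by (intro sum.cong) (auto simp: mult.commute Int_assoc)
    finally show "(\<integral>t. x (p t) \<partial>V) = (\<Sum>k\<in>p ` T. measure V (p -` {k} \<inter> T) * x k)" .
  qed
  have "\<bar>\<integral>t. x t - x (p t) \<partial>V\<bar> \<le> (\<integral>t. \<bar>x t - x (p t)\<bar> \<partial>V)"
    by (rule integral_abs_bound)
  also have "\<dots> \<le> (\<integral>t. \<epsilon> \<partial>V)"
    using x_int xp_int(1) p x(2) V(2) by (intro integral_mono) auto
  finally show ?thesis
    using x_int xp_int V(2) by (simp add: mult.commute)
qed

end

context gaussian_law
begin

text \<open>The image of a signed measure under the covariance operator is a uniform limit of kernel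
  functions.\<close>

lemma signed_cov_approx:
  assumes \<mu>: "\<mu> \<in> signed_measures T" and \<delta>: "\<delta> > 0"
  obtains f where "f \<in> point_functionals"
    "\<And>s. s \<in> T \<Longrightarrow> \<bar>signed_integral T \<mu> (\<lambda>t. cov (\<lambda>x. x s) (\<lambda>x. x t)) - kern f s\<bar> \<le> \<delta>"
proof -
  define V where "V = upper_variation T \<mu>"
  define W where "W = upper_variation T (\<lambda>A. - \<mu> A)"
  note neg = signed_measures_uminus[OF \<mu>]
  have V: "finite_measure V" "space V = T" "sets V = sets (restrict_space borel T)"
    unfolding V_def by (rule finite_measure_upper_variation[OF \<mu>] space_upper_variation[OF \<mu>] sets_upper_variation[OF \<mu>])+
  have W: "finite_measure W" "space W = T" "sets W = sets (restrict_space borel T)"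
    unfolding W_def by (rule finite_measure_upper_variation[OF neg] space_upper_variation[OF neg] sets_upper_variation[OF neg])+
  define m where "m = measure V T + measure W T + 1"
  have m: "m > 0" by (simp add: m_def add_nonneg_pos)
  define \<epsilon> where "\<epsilon> = \<delta> / m"
  have \<epsilon>: "\<epsilon> > 0" using \<delta> m by (simp add: \<epsilon>_def)
  let ?K = "\<lambda>s t. cov (\<lambda>x. x s) (\<lambda>x. x t)"
  have "uniformly_continuous_on (T \<times> T) (\<lambda>p. ?K (fst p) (snd p))"
    by (intro compact_uniformly_continuous covariance_function_continuous compact_Times compact_T)
  then obtain d where d: "d > 0" "\<And>p q. \<lbrakk>p \<in> T \<times> T; q \<in> T \<times> T; dist q p < d\<rbrakk>
      \<Longrightarrow> dist (?K (fst q) (snd q)) (?K (fst p) (snd p)) < \<epsilon>"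
    using \<epsilon> unfolding uniformly_continuous_on_def by metis
  have osc: "\<bar>?K s t - ?K s t'\<bar> \<le> \<epsilon>" if "s \<in> T" "t \<in> T" "t' \<in> T" "\<bar>t - t'\<bar> \<le> d / 2" for s t t'
    using d(2)[of "(s, t')" "(s, t)"] that d(1) by (simp add: dist_Pair_Pair dist_real_def)
  have cont: "continuous_on T (?K s)" if "s \<in> T" for s
    using that continuous_on_compose2[OF covariance_function_continuous, of T "\<lambda>t. (s, t)"]
      continuous_on_Pair[OF continuous_on_const continuous_on_id, of T s]
    by auto
  obtain p where p: "p \<in> borel_measurable borel" "finite (p ` T)" "p ` T \<subseteq> T" "\<And>t. t \<in> T \<Longrightarrow> \<bar>t - p t\<bar> \<le> d / 2"
    using discretization[of "d / 2"] d(1) by (metis half_gt_zero)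
  define c where "c k = measure V (p -` {k} \<inter> T) - measure W (p -` {k} \<inter> T)" for k
  define f where "f x = (\<Sum>k\<in>p ` T. c k * x k)" for x
  have f_eq: "f = (\<lambda>x. \<Sum>k\<in>p ` T. c k * x k)"
    by (simp add: f_def fun_eq_iff)
  have f: "f \<in> point_functionals"
    unfolding f_eq using p by (intro point_functional_sum)
  have "\<bar>signed_integral T \<mu> (?K s) - kern f s\<bar> \<le> \<delta>" if s: "s \<in> T" for s
  proof -
    have "kern f s = (\<Sum>k\<in>p ` T. c k * ?K s k)"
      using s cov_left_expand[OF p(2,3) f_eq point_functional_eval[OF s]]
      by (simp add: kern_def cov_commute)
    also have "\<dots> = (\<Sum>k\<in>p ` T. measure V (p -` {k} \<inter> T) * ?K s k) - (\<Sum>k\<in>p ` T. measure W (p -` {k} \<inter> T) * ?K s k)"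
      by (simp add: c_def left_diff_distrib sum_subtractf)
    finally have k: "kern f s = \<dots>" .
    have "\<bar>signed_integral T \<mu> (?K s) - kern f s\<bar> \<le> \<epsilon> * measure V T + \<epsilon> * measure W T"
      unfolding k signed_integral_def V_def[symmetric] W_def[symmetric]
      using integral_discretization[OF V p cont[OF s] osc[OF s]] integral_discretization[OF W p cont[OF s] osc[OF s]]
      by linarith
    also have "\<dots> \<le> \<epsilon> * m"
      using \<epsilon> by (simp add: m_def distrib_left)
    also have "\<dots> = \<delta>" using m by (simp add: \<epsilon>_def)
    finally show ?thesis .
  qed
  then show thesis using f that by blast
qed

end

section \<open>The support of a centered Gaussian vector\<close>

lemma centered_normal_distr:
  assumes Z: "Z \<in> measurable M N" and f: "f \<in> borel_measurable N"
    and X: "centered_normal M (\<lambda>\<omega>. f (Z \<omega>))"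
  shows "centered_normal (distr M N Z) f"
proof -
  have "distributed (distr M N Z) lborel f g \<longleftrightarrow> distributed M lborel (\<lambda>\<omega>. f (Z \<omega>)) g" for g
    using f measurable_compose[OF Z f] distr_distr[of f N lborel Z M] Z
    by (simp add: distributed_def comp_def)
  moreover have "(AE x in distr M N Z. f x = 0) \<longleftrightarrow> (AE \<omega> in M. f (Z \<omega>) = 0)"
    using f by (intro AE_distr_iff[OF Z]) measurable
  ultimately show ?thesis
    using X f by (simp add: centered_normal_def)
qed

theorem lemma3p4:
  fixes a b :: real and M :: "'w measure" and Z :: "'w \<Rightarrow> real \<Rightarrow> real"
    and T :: "real set" and P\<^sub>0 :: "(real \<Rightarrow> real) measure"
  assumes "a \<le> b" and "T = {a..b}"
    and "centered_gaussian_vector T M Z"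
    and "P\<^sub>0 = law T M Z"
  shows "CT_topology T closure_of (cov_operator T M Z ` signed_measures T)
           = CT_topology T closure_of shift_kernel T P\<^sub>0
         \<and> CT_topology T closure_of shift_kernel T P\<^sub>0 = supp T P\<^sub>0"
proof -
  interpret interval_space a b T by unfold_locales (rule assms)+
  have Z: "Z \<in> measurable M (CT_borel T)"
    and normal: "\<And>\<mu>. \<mu> \<in> signed_measures T \<Longrightarrow> centered_normal M (\<lambda>\<omega>. signed_integral T \<mu> (Z \<omega>))"
    using assms(3) by (auto simp: centered_gaussian_vector_def)
  interpret M: prob_space M using assms(3) by (simp add: centered_gaussian_vector_def)
  have P: "P\<^sub>0 = distr M (CT_borel T) Z" using assms(4) by (simp add: law_def)
  have Z_cont: "continuous_on T (Z \<omega>)" if "\<omega> \<in> space M" for \<omega>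
    using measurable_space[OF Z that] by (simp add: space_CT_borel mspace_CT_cont)
  have pf_normal: "centered_normal P\<^sub>0 f" if f: "f \<in> point_functionals" for f
  proof -
    obtain F c where F: "finite F" "F \<subseteq> T" "f = (\<lambda>x. \<Sum>t\<in>F. c t * x t)"
      using f by (auto simp: point_functionals_def)
    have eq: "signed_integral T (\<lambda>A. \<Sum>t\<in>F \<inter> A. c t) (Z \<omega>) = f (Z \<omega>)" if "\<omega> \<in> space M" for \<omega>
      unfolding F(3) by (rule signed_integral_point[OF F(1,2) Z_cont[OF that]])
    have f_meas: "f \<in> borel_measurable (CT_borel T)"
      using point_functional_measurable[OF f, of "\<lambda>x. x"] eval_measurable by auto
    have fZ: "(\<lambda>\<omega>. f (Z \<omega>)) \<in> borel_measurable M"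
      by (rule measurable_compose[OF Z f_meas])
    have "centered_normal M (\<lambda>\<omega>. f (Z \<omega>))"
    proof -
      have "distributed M lborel (\<lambda>\<omega>. signed_integral T (\<lambda>A. \<Sum>t\<in>F \<inter> A. c t) (Z \<omega>)) g
          \<longleftrightarrow> distributed M lborel (\<lambda>\<omega>. f (Z \<omega>)) g" for g
        using eq by (simp add: distributed_def cong: measurable_cong distr_cong)
      then show ?thesis
        using normal[OF point_signed_measure[OF F(1)], of c] fZ eq
        by (auto simp: centered_normal_def cong: AE_cong_simp)
    qed
    then show ?thesis
      unfolding P by (rule centered_normal_distr[OF Z f_meas])
  qed
  interpret gaussian_law a b T P\<^sub>0
    by (intro gaussian_law.intro interval_space_axioms gaussian_law_axioms.intro pf_normal)
      (simp_all add: P M.prob_space_distr[OF Z])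
  have cov_eq: "covariance M (\<lambda>\<omega>. Z \<omega> s) (\<lambda>\<omega>. Z \<omega> t) = cov (\<lambda>x. x s) (\<lambda>x. x t)" if "s \<in> T" "t \<in> T" for s t
  proof -
    have mean: "(\<integral>\<omega>. Z \<omega> u \<partial>M) = 0" if "u \<in> T" for u
      using integral_distr[OF Z eval_measurable[OF that]] pf_centered[OF point_functional_eval[OF that]]
      by (simp add: P)
    have "(\<lambda>x. x s * x t) \<in> borel_measurable (CT_borel T)"
      using eval_measurable that by measurable
    then show ?thesis
      using integral_distr[OF Z, of "\<lambda>x. x s * x t"] mean that unfolding P[symmetric]
      by (simp add: covariance_def cov_def)
  qed
  have K_eq: "cov_operator T M Z \<mu> s = signed_integral T \<mu> (\<lambda>t. cov (\<lambda>x. x s) (\<lambda>x. x t))"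
    if "\<mu> \<in> signed_measures T" "s \<in> T" for \<mu> s
  proof -
    have "signed_integral T \<mu> (\<lambda>t. covariance M (\<lambda>\<omega>. Z \<omega> s) (\<lambda>\<omega>. Z \<omega> t))
        = signed_integral T \<mu> (\<lambda>t. cov (\<lambda>x. x s) (\<lambda>x. x t))"
      unfolding signed_integral_def using that
      by (intro arg_cong2[of _ _ _ _ "(-)"] Bochner_Integration.integral_cong)
        (auto simp: cov_eq space_upper_variation signed_measures_uminus)
    then show ?thesis using that by (simp add: cov_operator_def)
  qed
  have "kern ` point_functionals \<subseteq> cov_operator T M Z ` signed_measures T"
  proof (rule image_subsetI)
    fix f assume f: "f \<in> point_functionals"
    obtain F c where F: "finite F" "F \<subseteq> T" "f = (\<lambda>x. \<Sum>t\<in>F. c t * x t)"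
      using f by (auto simp: point_functionals_def)
    define \<nu> where "\<nu> A = (\<Sum>t\<in>F \<inter> A. c t)" for A
    have \<nu>: "\<nu> \<in> signed_measures T"
      unfolding \<nu>_def by (rule point_signed_measure[OF F(1)])
    have "cov_operator T M Z \<nu> s = kern f s" for s
    proof (cases "s \<in> T")
      case True
      have "continuous_on T (\<lambda>t. cov (\<lambda>x. x s) (\<lambda>x. x t))"
        using True continuous_on_compose2[OF covariance_function_continuous, of T "\<lambda>t. (s, t)"]
          continuous_on_Pair[OF continuous_on_const continuous_on_id, of T s]
        by auto
      then have "cov_operator T M Z \<nu> s = (\<Sum>t\<in>F. c t * cov (\<lambda>x. x s) (\<lambda>x. x t))"
        unfolding K_eq[OF \<nu> True] \<nu>_def by (rule signed_integral_point[OF F(1,2)])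
      also have "\<dots> = kern f s"
        using True cov_left_expand[OF F point_functional_eval[OF True]] by (simp add: kern_def cov_commute)
      finally show ?thesis .
    qed (simp add: cov_operator_def kern_def)
    then have "kern f = cov_operator T M Z \<nu>" by auto
    then show "kern f \<in> cov_operator T M Z ` signed_measures T" using \<nu> by blast
  qed
  then have "CT_topology T closure_of (kern ` point_functionals)
      \<subseteq> CT_topology T closure_of (cov_operator T M Z ` signed_measures T)"
    by (rule closure_of_mono)
  moreover have "CT_topology T closure_of (cov_operator T M Z ` signed_measures T)
      \<subseteq> CT_topology T closure_of (kern ` point_functionals)"
  proof
    fix x assume x: "x \<in> CT_topology T closure_of (cov_operator T M Z ` signed_measures T)"
    have "\<exists>y\<in>kern ` point_functionals \<inter> mspace (CT T). \<forall>t\<in>T. \<bar>x t - y t\<bar> \<le> r" if r: "r > 0" for r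
    proof -
      have "r / 2 > 0" using r by simp
      then obtain \<mu> where \<mu>: "\<mu> \<in> signed_measures T" "\<And>t. t \<in> T \<Longrightarrow> \<bar>x t - cov_operator T M Z \<mu> t\<bar> \<le> r / 2"
        using x unfolding in_closure_CT_iff by blast
      obtain f where f: "f \<in> point_functionals" "\<And>t. t \<in> T \<Longrightarrow> \<bar>cov_operator T M Z \<mu> t - kern f t\<bar> \<le> r / 2"
        using signed_cov_approx[OF \<mu>(1) \<open>r / 2 > 0\<close>] K_eq[OF \<mu>(1)] by metis
      have "\<bar>x t - kern f t\<bar> \<le> r" if "t \<in> T" for t
        using \<mu>(2)[OF that] f(2)[OF that] by linarith
      then show ?thesis using f(1) kern_in_mspace by blast
    qed
    then show "x \<in> CT_topology T closure_of (kern ` point_functionals)"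
      using x by (auto simp: in_closure_CT_iff)
  qed
  ultimately show ?thesis
    using closure_kern_shift_kernel_supp by auto
qed

end
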